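(* Assume the van Kampen setup below with $B_k=X_k$ for $k=0,1,2$, and let $P_k:\vec\pi_1(X_k)\to\vec\pi_1(X_k,A_k)$, $k=0,1,2$, be compatible future retracts. Then the commutative square of categories $$\begin{array}{ccc}\vec\pi_1(X_0,A_0)&\xrightarrow{i'_2}&\vec\pi_1(X_2,A_2)\\ \downarrow{\scriptstyle i'_1}&&\downarrow{\scriptstyle j'_2}\\ \vec\pi_1(X_1,A_1)&\xrightarrow{j'_1}&\vec\pi_1(X,A)\end{array}$$ (all functors induced by inclusions) is a pushout in the category of (small) categories.
   Context: A d-space is a topological space with a set of continuous paths $[0,1]\to X$ (dipaths) containing all constant paths, closed under precomposition with continuous non-decreasing maps $[0,1]\to[0,1]$ and under concatenation; subsets carry the dipaths with image in them; a dimap is a continuous map preserving dipaths. $\vec I$ is $[0,1]$ with non-decreasing paths as dipaths. The fundamental category $\vec\pi_1(X)$ has objects the points of $X$ and morphisms $a\to b$ the classes of dipaths from $a$ to $b$ modulo the equivalence relation generated by endpoint-fixing directed homotopies (dimaps $H:\vec I\times\vec I\to X$ with $H(\cdot,0)=\gamma$, $H(\cdot,1)=\gamma'$, $H(0,s)=a$, $H(1,s)=b$); composition is concatenation. For $A\subseteq X$, $\vec\pi_1(X,A)$ is the full subcategory on objects in $A$. Inclusions induce functors. For $A\subseteq B\subseteq X$ with inclusion $\iota:\vec\pi_1(X,A)\to\vec\pi_1(X,B)$, a future retract is a functor $P:\vec\pi_1(X,B)\to\vec\pi_1(X,A)$ left adjoint to $\iota$ whose unit $\eta$ satisfies $\eta_a=\mathrm{id}_a$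 for $a\in A$. Van Kampen setup: $X$ a d-space, $X_1,X_2\subseteq X$ with $X=\mathrm{Int}(X_1)\cup\mathrm{Int}(X_2)$, dipaths of $X$ being the finite concatenations of dipaths of $X_1$ and $X_2$, $X_0=X_1\cap X_2$. For $k=0,1,2$, $A_k\subseteq B_k\subseteq X_k$ with $A_0=A_1\cap A_2$, $B_0=B_1\cap B_2$, $A=A_1\cup A_2$, $B=B_1\cup B_2$, $A=\mathrm{Int}_A(A_1)\cup\mathrm{Int}_A(A_2)$, $B=\mathrm{Int}_B(B_1)\cup\mathrm{Int}_B(B_2)$. Inclusion-induced functors: $i_k:\vec\pi_1(X_0,B_0)\to\vec\pi_1(X_k,B_k)$, $j_k:\vec\pi_1(X_k,B_k)\to\vec\pi_1(X,B)$, $i'_k:\vec\pi_1(X_0,A_0)\to\vec\pi_1(X_k,A_k)$, $j'_k:\vec\pi_1(X_k,A_k)\to\vec\pi_1(X,A)$ ($k=1,2$). Functors $P_k:\vec\pi_1(X_k,B_k)\to\vec\pi_1(X_k,A_k)$ ($k=0,1,2$) are compatible future retracts if each is a future retract with unit $\eta^k$, $P_k\circ i_k=i'_k\circ P_0$ for $k=1,2$, and for each $x\in B_0$ the image of $\eta^0_x$ in $\vec\pi_1(X_k)$ equals $\eta^k_x$. *)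

theory Defs
  imports "HOL-Analysis.Analysis"
begin

text \<open>A d-space is a subset X of a topological type (with the subspace topology)
together with a set D of dipaths. Paths are functions real => 'a, only their values
on [0,1] matter; we therefore require D to be closed under changing a path outside
[0,1] (representation convention).\<close>

definition dspace :: "'a::topological_space set \<Rightarrow> (real \<Rightarrow> 'a) set \<Rightarrow> bool" where
  "dspace X D \<longleftrightarrow>
     (\<forall>\<gamma>\<in>D. path \<gamma> \<and> path_image \<gamma> \<subseteq> X) \<and>
     (\<forall>x\<in>X. (\<lambda>t. x) \<in> D) \<and>
     (\<forall>\<gamma>\<in>D. \<forall>\<phi>. continuous_on {0..1} \<phi> \<and> \<phi> ` {0..1} \<subseteq> {0..1} \<and> mono_on {0..1} \<phi>
                 \<longrightarrow> \<gamma> \<circ> \<phi> \<in> D) \<and>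
     (\<forall>\<gamma>\<in>D. \<forall>\<delta>\<in>D. pathfinish \<gamma> = pathstart \<delta> \<longrightarrow> \<gamma> +++ \<delta> \<in> D) \<and>
     (\<forall>\<gamma>\<in>D. \<forall>\<delta>. (\<forall>t\<in>{0..1}. \<delta> t = \<gamma> t) \<longrightarrow> \<delta> \<in> D)"

definition dip :: "(real \<Rightarrow> 'a::topological_space) set \<Rightarrow> 'a set \<Rightarrow> (real \<Rightarrow> 'a) set" where
  "dip D Y = {\<gamma>\<in>D. path_image \<gamma> \<subseteq> Y}"

definition relint :: "'a::topological_space set \<Rightarrow> 'a set \<Rightarrow> 'a set" where
  "relint S T = \<Union>{U. openin (top_of_set S) U \<and> U \<subseteq> T}"

definition fin_concat :: "((real \<Rightarrow> 'a) \<Rightarrow> bool) \<Rightarrow> (real \<Rightarrow> 'a) \<Rightarrow> bool" where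
  "fin_concat P \<gamma> \<longleftrightarrow>
     (\<exists>n::nat. \<exists>t::nat \<Rightarrow> real. 1 \<le> n \<and> t 0 = 0 \<and> t n = 1 \<and>
        (\<forall>i<n. t i < t (Suc i)) \<and>
        (\<forall>i<n. P (\<lambda>s. \<gamma> (t i + s * (t (Suc i) - t i)))))"

text \<open>Dimaps from I x I (product d-structure: dipaths have both coordinates
non-decreasing) into the subspace Y.\<close>
definition dimap2 :: "(real \<Rightarrow> 'a::topological_space) set \<Rightarrow> 'a set \<Rightarrow> (real \<times> real \<Rightarrow> 'a) \<Rightarrow> bool" where
  "dimap2 D Y H \<longleftrightarrow>
     continuous_on ({0..1} \<times> {0..1}) H \<and> H ` ({0..1} \<times> {0..1}) \<subseteq> Y \<and>
     (\<forall>\<sigma>1 \<sigma>2. path \<sigma>1 \<and> path \<sigma>2 \<and> path_image \<sigma>1 \<subseteq> {0..1} \<and> path_image \<sigma>2 \<subseteq> {0..1} \<and>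
        mono_on {0..1} \<sigma>1 \<and> mono_on {0..1} \<sigma>2 \<longrightarrow> (\<lambda>t. H (\<sigma>1 t, \<sigma>2 t)) \<in> dip D Y)"

definition dhtp :: "(real \<Rightarrow> 'a::topological_space) set \<Rightarrow> 'a set \<Rightarrow> (real \<Rightarrow> 'a) \<Rightarrow> (real \<Rightarrow> 'a) \<Rightarrow> bool" where
  "dhtp D Y \<gamma> \<delta> \<longleftrightarrow>
     (\<exists>H. dimap2 D Y H \<and> (\<forall>t\<in>{0..1}. H (t, 0) = \<gamma> t \<and> H (t, 1) = \<delta> t) \<and>
          (\<forall>s\<in>{0..1}. H (0, s) = \<gamma> 0 \<and> H (1, s) = \<gamma> 1))"

definition dcls :: "(real \<Rightarrow> 'a::topological_space) set \<Rightarrow> 'a set \<Rightarrow> (real \<Rightarrow> 'a) \<Rightarrow> (real \<Rightarrow> 'a) set" where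
  "dcls D Y \<gamma> = {\<delta>. equivclp (dhtp D Y) \<gamma> \<delta>}"

record ('o, 'm) cat =
  Obj :: "'o set"
  Arr :: "'m set"
  Dom :: "'m \<Rightarrow> 'o"
  Cod :: "'m \<Rightarrow> 'o"
  Id  :: "'o \<Rightarrow> 'm"
  Comp :: "'m \<Rightarrow> 'm \<Rightarrow> 'm"   \<comment> \<open>Comp C g f = g o f\<close>

definition hom :: "('o, 'm, 'x) cat_scheme \<Rightarrow> 'o \<Rightarrow> 'o \<Rightarrow> 'm set" where
  "hom C x y = {f \<in> Arr C. Dom C f = x \<and> Cod C f = y}"

definition category :: "('o, 'm, 'x) cat_scheme \<Rightarrow> bool" where
  "category C \<longleftrightarrow>
     (\<forall>f\<in>Arr C. Dom C f \<in> Obj C \<and> Cod C f \<in> Obj C) \<and>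
     (\<forall>x\<in>Obj C. Id C x \<in> hom C x x) \<and>
     (\<forall>f\<in>Arr C. \<forall>g\<in>Arr C. Dom C g = Cod C f \<longrightarrow> Comp C g f \<in> hom C (Dom C f) (Cod C g)) \<and>
     (\<forall>f\<in>Arr C. Comp C (Id C (Cod C f)) f = f \<and> Comp C f (Id C (Dom C f)) = f) \<and>
     (\<forall>f\<in>Arr C. \<forall>g\<in>Arr C. \<forall>h\<in>Arr C. Dom C g = Cod C f \<and> Dom C h = Cod C g \<longrightarrow>
        Comp C h (Comp C g f) = Comp C (Comp C h g) f)"

definition is_functor :: "('o1, 'm1, 'x) cat_scheme \<Rightarrow> ('o2, 'm2, 'y) cat_scheme \<Rightarrow>
                       ('o1 \<Rightarrow> 'o2) \<times> ('m1 \<Rightarrow> 'm2) \<Rightarrow> bool" where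
  "is_functor C E F \<longleftrightarrow>
     (\<forall>x\<in>Obj C. fst F x \<in> Obj E) \<and>
     (\<forall>f\<in>Arr C. snd F f \<in> hom E (fst F (Dom C f)) (fst F (Cod C f))) \<and>
     (\<forall>x\<in>Obj C. snd F (Id C x) = Id E (fst F x)) \<and>
     (\<forall>f\<in>Arr C. \<forall>g\<in>Arr C. Dom C g = Cod C f \<longrightarrow> snd F (Comp C g f) = Comp E (snd F g) (snd F f))"

definition fcomp :: "('o2 \<Rightarrow> 'o3) \<times> ('m2 \<Rightarrow> 'm3) \<Rightarrow> ('o1 \<Rightarrow> 'o2) \<times> ('m1 \<Rightarrow> 'm2) \<Rightarrow>
                     ('o1 \<Rightarrow> 'o3) \<times> ('m1 \<Rightarrow> 'm3)" where
  "fcomp G F = (fst G \<circ> fst F, snd G \<circ> snd F)"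

definition feq :: "('o1, 'm1, 'x) cat_scheme \<Rightarrow> ('o1 \<Rightarrow> 'o2) \<times> ('m1 \<Rightarrow> 'm2) \<Rightarrow>
                   ('o1 \<Rightarrow> 'o2) \<times> ('m1 \<Rightarrow> 'm2) \<Rightarrow> bool" where
  "feq C F G \<longleftrightarrow> (\<forall>x\<in>Obj C. fst F x = fst G x) \<and> (\<forall>f\<in>Arr C. snd F f = snd G f)"

definition pushout_wrt ::
  "('o0, 'm0, 'x0) cat_scheme \<Rightarrow> ('o1, 'm1, 'x1) cat_scheme \<Rightarrow> ('o2, 'm2, 'x2) cat_scheme \<Rightarrow>
   ('o, 'm, 'x) cat_scheme \<Rightarrow>
   ('o0 \<Rightarrow> 'o1) \<times> ('m0 \<Rightarrow> 'm1) \<Rightarrow> ('o0 \<Rightarrow> 'o2) \<times> ('m0 \<Rightarrow> 'm2) \<Rightarrow>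
   ('o1 \<Rightarrow> 'o) \<times> ('m1 \<Rightarrow> 'm) \<Rightarrow> ('o2 \<Rightarrow> 'o) \<times> ('m2 \<Rightarrow> 'm) \<Rightarrow>
   ('oe, 'me, 'xe) cat_scheme \<Rightarrow> bool" where
  "pushout_wrt C0 C1 C2 C i1 i2 j1 j2 E \<longleftrightarrow>
     (\<forall>F1 F2. is_functor C1 E F1 \<and> is_functor C2 E F2 \<and> feq C0 (fcomp F1 i1) (fcomp F2 i2) \<longrightarrow>
        (\<exists>F. is_functor C E F \<and> feq C1 (fcomp F j1) F1 \<and> feq C2 (fcomp F j2) F2 \<and>
             (\<forall>G. is_functor C E G \<and> feq C1 (fcomp G j1) F1 \<and> feq C2 (fcomp G j2) F2 \<longrightarrow> feq C F G)))"

type_synonym 'a dmor = "'a \<times> 'a \<times> (real \<Rightarrow> 'a) set"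

definition rep :: "('a::topological_space) dmor \<Rightarrow> (real \<Rightarrow> 'a)" where
  "rep f = (SOME \<gamma>. \<gamma> \<in> snd (snd f))"

definition fcat :: "(real \<Rightarrow> 'a::topological_space) set \<Rightarrow> 'a set \<Rightarrow> 'a set \<Rightarrow> ('a, 'a dmor) cat" where
  "fcat D Y A = \<lparr> Obj = A,
     Arr = {(a, b, dcls D Y \<gamma>) | a b \<gamma>. a \<in> A \<and> b \<in> A \<and> \<gamma> \<in> dip D Y \<and> \<gamma> 0 = a \<and> \<gamma> 1 = b},
     Dom = fst, Cod = (\<lambda>f. fst (snd f)),
     Id = (\<lambda>a. (a, a, dcls D Y (\<lambda>t. a))),
     Comp = (\<lambda>g f. (fst f, fst (snd g), dcls D Y (rep f +++ rep g))) \<rparr>"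

definition incl :: "(real \<Rightarrow> 'a::topological_space) set \<Rightarrow> 'a set \<Rightarrow> ('a \<Rightarrow> 'a) \<times> ('a dmor \<Rightarrow> 'a dmor)" where
  "incl D Z = (\<lambda>x. x, \<lambda>f. (fst f, fst (snd f), dcls D Z (rep f)))"

text \<open>P : C -> Cs is a future retract with unit eta, where Cs is the full subcategory
of C (so the inclusion functor is the identity on objects and arrows): P is left
adjoint to the inclusion with unit eta, and eta is the identity on objects of Cs.\<close>
definition future_retract ::
  "('o, 'm, 'x) cat_scheme \<Rightarrow> ('o, 'm, 'y) cat_scheme \<Rightarrow> ('o \<Rightarrow> 'o) \<times> ('m \<Rightarrow> 'm) \<Rightarrow> ('o \<Rightarrow> 'm) \<Rightarrow> bool" where
  "future_retract C Cs P \<eta> \<longleftrightarrow>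
     is_functor C Cs P \<and>
     (\<forall>x\<in>Obj C. \<eta> x \<in> hom C x (fst P x)) \<and>
     (\<forall>f\<in>Arr C. Comp C (snd P f) (\<eta> (Dom C f)) = Comp C (\<eta> (Cod C f)) f) \<and>
     (\<forall>x\<in>Obj C. \<forall>a\<in>Obj Cs. \<forall>f\<in>hom C x a.
        \<exists>!g. g \<in> hom Cs (fst P x) a \<and> Comp C g (\<eta> x) = f) \<and>
     (\<forall>a\<in>Obj Cs. \<eta> a = Id C a)"

end

theory Submission
  imports Defs
begin

text \<open>Existence: composing the two given functors with the retractions \<open>P\<^sub>k\<close> yields functors on
  all of \<open>\<pi>\<^sub>1(X\<^sub>k)\<close> that agree on \<open>\<pi>\<^sub>1(X\<^sub>0)\<close>. Subdivide a dipath of \<open>X\<close> uniformly into pieces that lie in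
  \<open>X\<^sub>1\<close> or \<open>X\<^sub>2\<close> and multiply their values. The product does not depend on the subdivision, and a
  directed homotopy, cut into a grid of small squares, does not change it. Restricting to \<open>A\<close>
  recovers the given functors because each \<open>P\<^sub>k\<close> is the identity on \<open>\<pi>\<^sub>1(X\<^sub>k, A\<^sub>k)\<close>.

  Uniqueness: an arrow between points of \<open>A\<close> is a product of arrows of the \<open>X\<^sub>k\<close>. The units
  glue to a natural transformation that is the identity on \<open>A\<close>, so it is also the product of the
  images of these arrows under the \<open>P\<^sub>k\<close>, hence of arrows of the \<open>\<pi>\<^sub>1(X\<^sub>k, A\<^sub>k)\<close>.\<close>

section \<open>Dipaths and directed homotopies\<close>

text \<open>Cutting a dipath between points of \<open>A\<close> produces cut points outside
  \<open>A\<close>, where the given functors have no values. This is why the retractions enter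
  before any cutting, and why uniqueness must repair the ends of every piece by the units.

  Directed homotopies cannot be reversed, and a straight-line homotopy between two dipaths of the
  square is directed only when one dipath lies below the other. Reparametrization, the unit and
  associativity laws and the two sides of a grid cell are therefore all treated alike: two dipaths
  of the square with common ends are joined to their pointwise maximum, and a dimap of the square is
  applied. The equivalence relation generated by directed homotopies absorbs the opposite directions
  of the two links.

  Subdivisions are uniform because those into n and n' pieces have the one into n * n' pieces as a
  common refinement, so that independence only has to be checked when the number of pieces is
  multiplied.\<close>

lemma mono_on_joinpaths:
  fixes p q :: "real \<Rightarrow> real"
  assumes "mono_on {0..1} p" "mono_on {0..1} q" "p 1 = q 0"
  shows "mono_on {0..1} (p +++ q)"
proof (rule mono_onI)
  fix s t :: real
  assume st: "s \<in> {0..1}" "t \<in> {0..1}" "s \<le> t"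
  consider "t \<le> 1/2" | "s \<le> 1/2" "t > 1/2" | "s > 1/2"
    by linarith
  then show "(p +++ q) s \<le> (p +++ q) t"
  proof cases
    case 1
    then show ?thesis
      using st mono_onD[OF assms(1), of "2 * s" "2 * t"] by (simp add: joinpaths_def)
  next
    case 2
    have "p (2 * s) \<le> p 1"
      using st 2 by (intro mono_onD[OF assms(1)]) auto
    also have "p 1 = q 0" by fact
    also have "q 0 \<le> q (2 * t-1)"
      using st 2 by (intro mono_onD[OF assms(2)]) auto
    finally show ?thesis
      using 2 by (simp add: joinpaths_def)
  next
    case 3
    then show ?thesis
      using st mono_onD[OF assms(2), of "2 * s-1" "2 * t-1"] by (simp add: joinpaths_def)
  qed
qed

lemma linepath_real: "linepath a b t = a + t * (b - a)" for a b t :: real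
  by (simp add: linepath_def algebra_simps)

lemma linepath_real_in:
  fixes a b t :: real
  assumes "a \<le> b" "t \<in> {0..1}"
  shows "linepath a b t \<in> {a..b}"
proof -
  have "0 \<le> t * (b - a)" "t * (b - a) \<le> 1 * (b - a)"
    using assms by (auto intro: mult_left_le_one_le)
  then show ?thesis by (simp add: linepath_real)
qed

lemma mono_on_linepath: "a \<le> b \<Longrightarrow> mono_on S (linepath a b)" for a b :: real
  by (auto simp: linepath_real intro!: mono_onI mult_right_mono)

lemma continuous_on_linepath_real: "continuous_on S (linepath a b)" for a b :: real
  unfolding linepath_real[abs_def] by (intro continuous_intros)

text \<open>Packing both coordinates into one map turns the condition in \<open>dimap2\<close> into
  closure under composition \<open>H \<circ> p\<close>, and lets dipaths of the square be joined by
  \<open>+++\<close>.\<close>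

definition square_dipath :: "(real \<Rightarrow> real \<times> real) \<Rightarrow> bool" where
  "square_dipath p \<longleftrightarrow> path p \<and> path_image p \<subseteq> {0..1} \<times> {0..1} \<and>
     mono_on {0..1} (fst \<circ> p) \<and> mono_on {0..1} (snd \<circ> p)"

lemma square_dipath_pairI:
  assumes "continuous_on {0..1} a" "continuous_on {0..1} b"
    and "\<And>t. t \<in> {0..1} \<Longrightarrow> a t \<in> {0..1}" "\<And>t. t \<in> {0..1} \<Longrightarrow> b t \<in> {0..1}"
    and "mono_on {0..1} a" "mono_on {0..1} b"
  shows "square_dipath (\<lambda>t. (a t, b t))"
proof -
  have "path (\<lambda>t. (a t, b t))"
    unfolding path_def using assms by (intro continuous_on_Pair)
  moreover have "path_image (\<lambda>t. (a t, b t)) \<subseteq> {0..1} \<times> {0..1}"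
    using assms(3,4) unfolding path_image_def by blast
  ultimately show ?thesis
    using assms(5,6) by (simp add: square_dipath_def comp_def)
qed

lemma square_dipathD:
  assumes "square_dipath p"
  shows "continuous_on {0..1} p"
    and "continuous_on {0..1} (\<lambda>t. fst (p t))" "continuous_on {0..1} (\<lambda>t. snd (p t))"
    and "mono_on {0..1} (\<lambda>t. fst (p t))" "mono_on {0..1} (\<lambda>t. snd (p t))"
  using assms unfolding square_dipath_def path_def comp_def
  by (auto intro: continuous_on_fst continuous_on_snd)

lemma square_dipath_join:
  assumes "square_dipath p" "square_dipath q" "p 1 = q 0"
  shows "square_dipath (p +++ q)"
proof -
  have "pathfinish p = pathstart q"
    using assms(3) by (simp add: pathfinish_def pathstart_def)
  then show ?thesis
    using assms unfolding square_dipath_def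
    by (simp add: path_image_join path_compose_join mono_on_joinpaths)
qed

lemma square_dipath_linepath:
  assumes "0 \<le> a" "a \<le> a'" "a' \<le> 1" "0 \<le> b" "b \<le> b'" "b' \<le> 1"
  shows "square_dipath (linepath (a,b) (a',b'))"
proof -
  have "square_dipath (\<lambda>t. (linepath a a' t, linepath b b' t))"
  proof (intro square_dipath_pairI continuous_on_linepath_real mono_on_linepath)
    fix t :: real assume "t \<in> {0..1}"
    then show "linepath a a' t \<in> {0..1}" "linepath b b' t \<in> {0..1}"
      using linepath_real_in[of a a' t] linepath_real_in[of b b' t] assms by auto
  qed (use assms in auto)
  then show ?thesis by (simp add: linepath_def)
qed

lemma square_dipath_le:
  assumes "square_dipath p" "s \<in> {0..1}" "t \<in> {0..1}" "s \<le> t"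
  shows "fst (p s) \<le> fst (p t)" "snd (p s) \<le> snd (p t)"
  using assms unfolding square_dipath_def mono_on_def by auto

lemma square_dipath_in:
  assumes "square_dipath p" "t \<in> {0..1}"
  shows "fst (p t) \<in> {0..1}" "snd (p t) \<in> {0..1}"
proof -
  have "p t \<in> {0..1} \<times> {0..1}"
    using assms unfolding square_dipath_def path_image_def by blast
  then show "fst (p t) \<in> {0..1}" "snd (p t) \<in> {0..1}"
    by (auto simp: mem_Times_iff)
qed

lemma dimap2_alt:
  "dimap2 D Y H \<longleftrightarrow> continuous_on ({0..1} \<times> {0..1}) H \<and> H ` ({0..1} \<times> {0..1}) \<subseteq> Y \<and>
     (\<forall>p. square_dipath p \<longrightarrow> H \<circ> p \<in> dip D Y)"
proof -
  have "(\<forall>\<sigma>1 \<sigma>2. path \<sigma>1 \<and> path \<sigma>2 \<and> path_image \<sigma>1 \<subseteq> {0..1} \<and> path_image \<sigma>2 \<subseteq> {0..1} \<and>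
        mono_on {0..1} \<sigma>1 \<and> mono_on {0..1} \<sigma>2 \<longrightarrow> (\<lambda>t. H (\<sigma>1 t, \<sigma>2 t)) \<in> dip D Y)
     \<longleftrightarrow> (\<forall>p. square_dipath p \<longrightarrow> H \<circ> p \<in> dip D Y)" (is "?L \<longleftrightarrow> ?R")
  proof
    assume L: ?L
    show ?R
    proof (intro allI impI)
      fix p assume p: "square_dipath p"
      have "(\<lambda>t. H ((fst \<circ> p) t, (snd \<circ> p) t)) \<in> dip D Y"
      proof (intro L[rule_format] conjI)
        show "path (fst \<circ> p)" "path (snd \<circ> p)"
          using square_dipathD[OF p] by (simp_all add: path_def comp_def)
        show "path_image (fst \<circ> p) \<subseteq> {0..1}" "path_image (snd \<circ> p) \<subseteq> {0..1}"
          using p by (auto simp: square_dipath_def path_image_def)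
        show "mono_on {0..1} (fst \<circ> p)" "mono_on {0..1} (snd \<circ> p)"
          using p by (simp_all add: square_dipath_def)
      qed
      then show "H \<circ> p \<in> dip D Y" by (simp add: comp_def)
    qed
  next
    assume R: ?R
    show ?L
    proof (intro allI impI, elim conjE)
      fix \<sigma>1 \<sigma>2 :: "real \<Rightarrow> real"
      assume "path \<sigma>1" "path \<sigma>2" "path_image \<sigma>1 \<subseteq> {0..1}" "path_image \<sigma>2 \<subseteq> {0..1}"
        "mono_on {0..1} \<sigma>1" "mono_on {0..1} \<sigma>2"
      then have "square_dipath (\<lambda>t. (\<sigma>1 t, \<sigma>2 t))"
        by (intro square_dipath_pairI) (auto simp: path_def path_image_def image_subset_iff)
      with R show "(\<lambda>t. H (\<sigma>1 t, \<sigma>2 t)) \<in> dip D Y" by (auto simp: comp_def)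
    qed
  qed
  then show ?thesis unfolding dimap2_def by blast
qed

lemma dimap2_mono: "dimap2 D Y H \<Longrightarrow> Y \<subseteq> Z \<Longrightarrow> dimap2 D Z H"
  unfolding dimap2_alt dip_def by blast

lemma dhtp_mono: "dhtp D Y \<gamma> \<delta> \<Longrightarrow> Y \<subseteq> Z \<Longrightarrow> dhtp D Z \<gamma> \<delta>"
  unfolding dhtp_def using dimap2_mono by blast

text \<open>Serves to transport dihomotopy classes along an inclusion of subspaces: every link of a
  zigzag in the smaller one is also a link in the larger one.\<close>

lemma equivclp_mono_rel:
  assumes "equivclp r x y" "\<And>x y. r x y \<Longrightarrow> r' x y"
  shows "equivclp r' x y"
  using assms(1)
proof (induction rule: equivclp_induct)
  case base
  then show ?case by (simp add: equivclp_def)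
next
  case (step y z)
  then have "equivclp r' y z"
    using assms(2) by (metis equivclp_sym r_into_equivclp)
  with step.IH show ?case by (rule equivclp_trans)
qed

definition unit_dipath :: "(real \<Rightarrow> real) \<Rightarrow> bool" where
  "unit_dipath \<phi> \<longleftrightarrow> continuous_on {0..1} \<phi> \<and> \<phi> ` {0..1} \<subseteq> {0..1} \<and> mono_on {0..1} \<phi>"

lemma unit_dipath_linepath:
  assumes "0 \<le> a" "a \<le> b" "b \<le> 1"
  shows "unit_dipath (linepath a b)"
proof -
  have "linepath a b ` {0..1} \<subseteq> {0..1}"
    by (rule image_subsetI) (use linepath_real_in[OF assms(2)] assms in force)
  then show ?thesis
    using assms by (simp add: unit_dipath_def continuous_on_linepath_real mono_on_linepath)
qed

lemma unit_dipath_join: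
  assumes "unit_dipath \<phi>" "unit_dipath \<psi>" "\<phi> 1 = \<psi> 0"
  shows "unit_dipath (\<phi> +++ \<psi>)"
proof -
  have "path_image (\<phi> +++ \<psi>) \<subseteq> path_image \<phi> \<union> path_image \<psi>"
    by (rule path_image_join_subset)
  moreover have "continuous_on {0..1} (\<phi> +++ \<psi>)"
    using assms by (intro continuous_on_joinpaths) (auto simp: unit_dipath_def pathfinish_def pathstart_def)
  ultimately show ?thesis
    using assms mono_on_joinpaths[of \<phi> \<psi>] unfolding unit_dipath_def path_image_def by blast
qed

section \<open>Closure properties of dipaths in a d-space and its subspaces\<close>

locale directed_space =
  fixes X :: "'a::topological_space set" and D :: "(real \<Rightarrow> 'a) set"
  assumes dspace: "dspace X D"
begin

lemma D_path: "\<gamma> \<in> D \<Longrightarrow> path \<gamma>"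
  and D_image: "\<gamma> \<in> D \<Longrightarrow> path_image \<gamma> \<subseteq> X"
  and D_const: "x \<in> X \<Longrightarrow> (\<lambda>t. x) \<in> D"
  and D_join: "\<gamma> \<in> D \<Longrightarrow> \<delta> \<in> D \<Longrightarrow> \<gamma> 1 = \<delta> 0 \<Longrightarrow> \<gamma> +++ \<delta> \<in> D"
  using dspace unfolding dspace_def pathfinish_def pathstart_def by blast+

lemma D_reparam: "\<gamma> \<in> D \<Longrightarrow> unit_dipath \<phi> \<Longrightarrow> \<gamma> \<circ> \<phi> \<in> D"
  using dspace unfolding dspace_def unit_dipath_def by blast

lemma D_cong: "\<gamma> \<in> D \<Longrightarrow> (\<And>t. t \<in> {0..1} \<Longrightarrow> \<delta> t = \<gamma> t) \<Longrightarrow> \<delta> \<in> D"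
  using dspace unfolding dspace_def by blast

lemma dip_cong: "\<gamma> \<in> dip D Y \<Longrightarrow> (\<And>t. t \<in> {0..1} \<Longrightarrow> \<delta> t = \<gamma> t) \<Longrightarrow> \<delta> \<in> dip D Y"
  unfolding dip_def using D_cong by (auto simp: path_image_def)

lemma dip_space: "dip D X = D"
  unfolding dip_def using D_image by blast

lemma dip_join:
  assumes "\<gamma> \<in> dip D Y" "\<delta> \<in> dip D Y" "\<gamma> 1 = \<delta> 0"
  shows "\<gamma> +++ \<delta> \<in> dip D Y"
proof -
  have "pathfinish \<gamma> = pathstart \<delta>"
    using assms(3) by (simp add: pathfinish_def pathstart_def)
  then show ?thesis
    using assms D_join unfolding dip_def by (simp add: path_image_join)
qed

lemma dip_const: "x \<in> Y \<Longrightarrow> Y \<subseteq> X \<Longrightarrow> (\<lambda>t. x) \<in> dip D Y"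
  unfolding dip_def using D_const by (auto simp: path_image_def)

text \<open>The axioms of a d-space concatenate at time 1/2 only. Concatenating the two rescaled
  parts there and then precomposing with a monotone map that sends c to 1/2 recovers
  \<gamma>.\<close>

lemma D_unsplit:
  assumes c: "0 \<le> c" "c \<le> 1" and 1: "\<gamma> \<circ> linepath 0 c \<in> D" and 2: "\<gamma> \<circ> linepath c 1 \<in> D"
  shows "\<gamma> \<in> D"
proof -
  consider "c = 0" | "c = 1" | "0 < c" "c < 1" using c by linarith
  then show ?thesis
  proof cases
    case 1
    then show ?thesis using D_cong[OF 2] by (simp add: linepath_real)
  next
    case 2
    then show ?thesis using D_cong[OF 1] by (simp add: linepath_real)
  next
    case 3
    \<comment> \<open>Affine from \<open>{0..c}\<close> onto \<open>{0..1/2}\<close> and from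
      \<open>{c..1}\<close> onto \<open>{1/2..1}\<close>. The slopes divide by c and by 1 - c, so
      the values c = 0 and c = 1 were split off above.\<close>
    define \<phi> where "\<phi> t = (if t \<le> c then t / (2 * c) else 1/2 + (t - c) / (2 * (1-c)))" for t
    have cont: "continuous_on {0..1} \<phi>"
      unfolding \<phi>_def using 3 by (intro continuous_on_cases_le continuous_intros) auto
    have lo: "0 \<le> \<phi> t" "\<phi> t \<le> 1/2" if "0 \<le> t" "t \<le> c" for t
      using that 3 by (auto simp: \<phi>_def field_simps)
    have hi: "1/2 < \<phi> t" "\<phi> t \<le> 1" if "c < t" "t \<le> 1" for t
      using that 3 by (auto simp: \<phi>_def field_simps)
    have ran: "\<phi> ` {0..1} \<subseteq> {0..1}"
    proof
      fix y assume "y \<in> \<phi> ` {0..1}"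
      then obtain t where t: "t \<in> {0..1}" "y = \<phi> t" by blast
      then show "y \<in> {0..1}"
        using lo[of t] hi[of t] by (cases "t \<le> c") auto
    qed
    have mono: "mono_on {0..1} \<phi>"
    proof (rule mono_onI)
      fix s t :: real assume st: "s \<in> {0..1}" "t \<in> {0..1}" "s \<le> t"
      consider "t \<le> c" | "s \<le> c" "t > c" | "s > c" by linarith
      then show "\<phi> s \<le> \<phi> t"
      proof cases
        case 1 with st \<open>0 < c\<close> show ?thesis by (auto simp: \<phi>_def intro!: divide_right_mono)
      next
        case 2 with st show ?thesis using lo(2)[of s] hi(1)[of t] by auto
      next
        case 3 with st \<open>c < 1\<close> show ?thesis by (auto simp: \<phi>_def intro!: divide_right_mono)
      qed
    qed
    have "(\<gamma> \<circ> linepath 0 c) +++ (\<gamma> \<circ> linepath c 1) \<in> D"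
      by (rule D_join) (use 1 2 in \<open>auto simp: linepath_real\<close>)
    then have "((\<gamma> \<circ> linepath 0 c) +++ (\<gamma> \<circ> linepath c 1)) \<circ> \<phi> \<in> D"
      by (rule D_reparam) (use cont ran mono in \<open>simp add: unit_dipath_def\<close>)
    then show ?thesis
    proof (rule D_cong)
      fix t :: real assume t: "t \<in> {0..1}"
      show "\<gamma> t = (((\<gamma> \<circ> linepath 0 c) +++ (\<gamma> \<circ> linepath c 1)) \<circ> \<phi>) t"
      proof (cases "t \<le> c")
        case True
        then have "2 * \<phi> t * c = t" using 3 by (simp add: \<phi>_def)
        then show ?thesis using lo(2)[of t] True t by (simp add: joinpaths_def linepath_real)
      next
        case False
        then have "(2 * \<phi> t - 1) * (1-c) = t - c" using 3 by (simp add: \<phi>_def field_simps)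
        then show ?thesis using hi(1)[of t] False t by (simp add: joinpaths_def linepath_real)
      qed
    qed
  qed
qed

section \<open>Directed homotopies and concatenation\<close>

lemma dimap2_path:
  assumes "\<gamma> \<in> dip D Y"
  shows "dimap2 D Y (\<lambda>x. \<gamma> (fst x))"
proof -
  have \<gamma>: "\<gamma> \<in> D" "path_image \<gamma> \<subseteq> Y" "continuous_on {0..1} \<gamma>"
    using assms D_path unfolding dip_def path_def by auto
  have "continuous_on ({0..1} \<times> {0..1}) (\<lambda>x::real\<times>real. \<gamma> (fst x))"
    by (rule continuous_on_compose2[OF \<gamma>(3)]) (auto intro: continuous_intros)
  moreover have "(\<lambda>x. \<gamma> (fst x)) ` ({0..1} \<times> {0..1}) \<subseteq> Y"
    using \<gamma>(2) by (auto simp: path_image_def)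
  moreover have "(\<lambda>x. \<gamma> (fst x)) \<circ> p \<in> dip D Y" if p: "square_dipath p" for p
  proof -
    have "\<gamma> \<circ> (fst \<circ> p) \<in> D"
      using square_dipathD[OF p] square_dipath_in[OF p]
      by (intro D_reparam[OF \<gamma>(1)]) (simp add: unit_dipath_def comp_def image_subset_iff)
    moreover have "path_image (\<gamma> \<circ> (fst \<circ> p)) \<subseteq> Y"
      using \<gamma>(2) square_dipath_in(1)[OF p] by (auto simp: path_image_def)
    ultimately show ?thesis by (simp add: dip_def comp_def)
  qed
  ultimately show ?thesis unfolding dimap2_alt by blast
qed

text \<open>The homotopy that is constant in the second variable does not see values outside
  \<open>{0..1}\<close>. Since dipaths are functions on all reals, this replaces equality when two
  formulas agree on the unit interval only.\<close>

lemma dhtp_eq_on: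
  assumes "\<gamma> \<in> dip D Y" "\<And>t. t \<in> {0..1} \<Longrightarrow> \<delta> t = \<gamma> t"
  shows "dhtp D Y \<gamma> \<delta>"
  unfolding dhtp_def using dimap2_path[OF assms(1)] assms(2)
  by (intro exI[of _ "\<lambda>x. \<gamma> (fst x)"]) auto

text \<open>Bottom and top row are composites of the homotopy with horizontal segments of the
  square, hence dipaths; they share their ends because the vertical sides are constant.\<close>

lemma dhtp_dip:
  assumes "dhtp D Y \<gamma> \<delta>"
  shows "\<gamma> \<in> dip D Y" "\<delta> \<in> dip D Y" "\<delta> 0 = \<gamma> 0" "\<delta> 1 = \<gamma> 1"
proof -
  obtain H where H: "dimap2 D Y H" "\<And>t. t\<in>{0..1} \<Longrightarrow> H (t, 0) = \<gamma> t" "\<And>t. t\<in>{0..1} \<Longrightarrow> H (t, 1) = \<delta> t"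
      "\<And>s. s\<in>{0..1} \<Longrightarrow> H (0, s) = \<gamma> 0" "\<And>s. s\<in>{0..1} \<Longrightarrow> H (1, s) = \<gamma> 1"
    using assms unfolding dhtp_def by blast
  have *: "H \<circ> linepath (0,s) (1,s) \<in> dip D Y" if "s \<in> {0..1}" for s
    using H(1) that square_dipath_linepath[of 0 1 s s] unfolding dimap2_alt by auto
  show "\<gamma> \<in> dip D Y"
    by (rule dip_cong[OF *[of 0]]) (auto simp: linepath_def H)
  show "\<delta> \<in> dip D Y"
    by (rule dip_cong[OF *[of 1]]) (auto simp: linepath_def H algebra_simps)
  show "\<delta> 0 = \<gamma> 0" "\<delta> 1 = \<gamma> 1"
    using H(3)[of 0] H(3)[of 1] H(4)[of 1] H(5)[of 1] by auto
qed

lemma equiv_dip: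
  assumes "equivclp (dhtp D Y) \<gamma> \<delta>" "\<gamma> \<in> dip D Y"
  shows "\<delta> \<in> dip D Y \<and> \<delta> 0 = \<gamma> 0 \<and> \<delta> 1 = \<gamma> 1"
  using assms
proof (induction rule: equivclp_induct)
  case (step y z)
  then show ?case using dhtp_dip by metis
qed auto

text \<open>The two homotopies are placed side by side along the seam t = 1/2. The real work is
  directedness: every dipath of the square, including those that cross the seam, must be sent to a
  dipath.\<close>

lemma dhtp_join:
  assumes 1: "dhtp D Y \<gamma> \<gamma>'" and 2: "dhtp D Y \<delta> \<delta>'" and ends: "\<gamma> 1 = \<delta> 0"
  shows "dhtp D Y (\<gamma> +++ \<delta>) (\<gamma>' +++ \<delta>')"
proof -
  obtain H where H: "dimap2 D Y H" "\<And>t. t\<in>{0..1} \<Longrightarrow> H (t, 0) = \<gamma> t" "\<And>t. t\<in>{0..1} \<Longrightarrow> H (t, 1) = \<gamma>' t"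
      "\<And>s. s\<in>{0..1} \<Longrightarrow> H (0, s) = \<gamma> 0" "\<And>s. s\<in>{0..1} \<Longrightarrow> H (1, s) = \<gamma> 1"
    using 1 unfolding dhtp_def by blast
  obtain K where K: "dimap2 D Y K" "\<And>t. t\<in>{0..1} \<Longrightarrow> K (t, 0) = \<delta> t" "\<And>t. t\<in>{0..1} \<Longrightarrow> K (t, 1) = \<delta>' t"
      "\<And>s. s\<in>{0..1} \<Longrightarrow> K (0, s) = \<delta> 0" "\<And>s. s\<in>{0..1} \<Longrightarrow> K (1, s) = \<delta> 1"
    using 2 unfolding dhtp_def by blast
  define L where "L x = ((\<lambda>t. H (t, snd x)) +++ (\<lambda>t. K (t, snd x))) (fst x)" for x
  have L1: "L (t, s) = H (2 * t, s)" if "t \<le> 1/2" for t s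
    using that by (simp add: L_def joinpaths_def)
  \<comment> \<open>The formula with \<open>K\<close> also holds on the seam itself, where both
    homotopies take the constant value \<gamma> 1 = \<delta> 0. This constancy is known only for s
    in \<open>{0..1}\<close>.\<close>
  have L2: "L (t, s) = K (2 * t-1, s)" if "t \<ge> 1/2" "s \<in> {0..1}" for t s
    proof (cases "t = 1/2")
    case True
    then have "2 * t = 1" by simp
    then show ?thesis using that H(5)[of s] K(4)[of s] ends by (simp add: L_def joinpaths_def)
  qed (use that in \<open>auto simp: L_def joinpaths_def\<close>)
  have cH: "continuous_on ({0..1} \<times> {0..1}) H" and cK: "continuous_on ({0..1} \<times> {0..1}) K"
    using H(1) K(1) unfolding dimap2_def by auto
  \<comment> \<open>The library lemma on joining parametrized paths takes the parameter as first
    coordinate, hence the swap here and the swap back in \<open>contL\<close>.\<close>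
  have c1: "continuous_on ({0..1} \<times> {0..1}) (\<lambda>y. H (snd y, fst y))"
    by (rule continuous_on_compose2[OF cH]) (auto intro!: continuous_intros)
  have c2: "continuous_on ({0..1} \<times> {0..1}) (\<lambda>y. K (snd y, fst y))"
    by (rule continuous_on_compose2[OF cK]) (auto intro!: continuous_intros)
  have c3: "continuous_on ({0..1} \<times> {0..1})
      (\<lambda>y. ((\<lambda>t. H (t, fst y)) +++ (\<lambda>t. K (t, fst y))) (snd y))"
    by (rule continuous_on_homotopic_join_lemma[of "\<lambda>s t. H (t, s)" "\<lambda>s t. K (t, s)", OF c1 c2])
      (use H(5) K(4) ends in \<open>simp add: pathfinish_def pathstart_def\<close>)
  have contL: "continuous_on ({0..1} \<times> {0..1}) L"
  proof -
    have "continuous_on ({0..1} \<times> {0..1})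
        (\<lambda>x. (\<lambda>y. ((\<lambda>t. H (t, fst y)) +++ (\<lambda>t. K (t, fst y))) (snd y)) (snd x, fst x))"
      by (rule continuous_on_compose2[OF c3]) (auto intro!: continuous_intros)
    then show ?thesis by (simp add: L_def[abs_def])
  qed
  have imL: "L (t, s) \<in> Y" if "t \<in> {0..1}" "s \<in> {0..1}" for t s
  proof (cases "t \<le> 1/2")
    case True
    then have "(2 * t, s) \<in> {0..1} \<times> {0..1}" using that by auto
    then show ?thesis using H(1) L1[OF True] unfolding dimap2_def by (auto simp del: mem_Times_iff)
  next
    case False
    then have "(2 * t-1, s) \<in> {0..1} \<times> {0..1}" using that by auto
    then show ?thesis using K(1) L2[of t s] False that unfolding dimap2_def by (auto simp del: mem_Times_iff)
  qed
  have low: "L \<circ> p \<in> D" if p: "square_dipath p" and le: "\<And>t. t \<in> {0..1} \<Longrightarrow> fst (p t) \<le> 1/2" for p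
  proof -
    have "square_dipath (\<lambda>t. (2 * fst (p t), snd (p t)))"
    proof (intro square_dipath_pairI continuous_intros square_dipathD[OF p])
      fix t :: real assume "t \<in> {0..1}"
      then show "2 * fst (p t) \<in> {0..1}" "snd (p t) \<in> {0..1}"
        using le[of t] square_dipath_in[OF p, of t] by auto
    next
      show "mono_on {0..1} (\<lambda>t. 2 * fst (p t))"
        using square_dipathD(4)[OF p] by (simp add: mono_on_def)
    qed
    then have "H \<circ> (\<lambda>t. (2 * fst (p t), snd (p t))) \<in> D"
      using H(1) unfolding dimap2_alt dip_def by blast
    then show ?thesis
      by (rule D_cong) (use L1 le in \<open>auto simp: L_def joinpaths_def\<close>)
  qed
  have high: "L \<circ> p \<in> D" if p: "square_dipath p" and ge: "\<And>t. t \<in> {0..1} \<Longrightarrow> fst (p t) \<ge> 1/2" for p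
  proof -
    have "square_dipath (\<lambda>t. (2 * fst (p t) - 1, snd (p t)))"
    proof (intro square_dipath_pairI continuous_intros square_dipathD[OF p])
      fix t :: real assume "t \<in> {0..1}"
      then show "2 * fst (p t) - 1 \<in> {0..1}" "snd (p t) \<in> {0..1}"
        using ge[of t] square_dipath_in[OF p, of t] by auto
    next
      show "mono_on {0..1} (\<lambda>t. 2 * fst (p t) - 1)"
        using square_dipathD(4)[OF p] by (simp add: mono_on_def)
    qed
    then have "K \<circ> (\<lambda>t. (2 * fst (p t) - 1, snd (p t))) \<in> D"
      using K(1) unfolding dimap2_alt dip_def by blast
    then show ?thesis
    proof (rule D_cong)
      fix t :: real assume t: "t \<in> {0..1}"
      then show "(L \<circ> p) t = (K \<circ> (\<lambda>t. (2 * fst (p t) - 1, snd (p t)))) t"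
        using L2[OF ge[OF t] square_dipath_in(2)[OF p t]] by simp
    qed
  qed
  have DL: "L \<circ> p \<in> D" if p: "square_dipath p" for p
  proof -
    have le: "fst (p s) \<le> fst (p t)" if "s \<in> {0..1}" "t \<in> {0..1}" "s \<le> t" for s t
      using square_dipath_le(1)[OF p that] .
    consider "fst (p 1) \<le> 1/2" | "fst (p 0) \<ge> 1/2" | "fst (p 0) < 1/2" "fst (p 1) > 1/2"
      by linarith
    then show ?thesis
    proof cases
      case 1
      have "fst (p t) \<le> 1/2" if "t \<in> {0..1}" for t
        using le[of t 1] that 1 by auto
      then show ?thesis by (rule low[OF p])
    next
      case 2
      have "fst (p t) \<ge> 1/2" if "t \<in> {0..1}" for t
        using le[of 0 t] that 2 by auto
      then show ?thesis by (rule high[OF p])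
    next
      case 3
      \<comment> \<open>The first coordinate is non-decreasing, so a single crossing time separates
        the part left of the seam from the part right of it. \<open>D_unsplit\<close> reassembles
        the images at that time.\<close>
      obtain c where c: "0 \<le> c" "c \<le> 1" "fst (p c) = 1/2"
        using IVT'[of "\<lambda>t. fst (p t)" 0 "1/2" 1] square_dipathD(2)[OF p] 3 by auto
      have seg: "square_dipath (p \<circ> linepath u v)" if uv: "0 \<le> u" "u \<le> v" "v \<le> 1" for u v
      proof -
        have in01: "linepath u v t \<in> {0..1}" if "t \<in> {0..1}" for t
          using linepath_real_in[OF uv(2) that] uv by auto
        have "continuous_on {0..1} (\<lambda>t. p (linepath u v t))"
          by (rule continuous_on_compose2[OF square_dipathD(1)[OF p] continuous_on_linepath_real])
            (use in01 in blast)
        moreover have "mono_on {0..1} (fst \<circ> (p \<circ> linepath u v))" "mono_on {0..1} (snd \<circ> (p \<circ> linepath u v))"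
          using in01 mono_onD[OF mono_on_linepath[OF uv(2), of UNIV]] square_dipath_le[OF p]
          by (simp_all add: mono_on_def)
        moreover have "path_image (p \<circ> linepath u v) \<subseteq> {0..1} \<times> {0..1}"
          using square_dipath_in[OF p] in01 by (simp add: path_image_def image_subset_iff mem_Times_iff)
        ultimately show ?thesis by (simp add: square_dipath_def path_def comp_def)
      qed
      have "L \<circ> (p \<circ> linepath 0 c) \<in> D"
      proof (rule low)
        show "square_dipath (p \<circ> linepath 0 c)" using c by (intro seg) auto
        fix t :: real assume "t \<in> {0..1}"
        then show "fst ((p \<circ> linepath 0 c) t) \<le> 1/2"
          using linepath_real_in[of 0 c t] c le[of "linepath 0 c t" c] by auto
      qed
      moreover have "L \<circ> (p \<circ> linepath c 1) \<in> D"
      proof (rule high)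
        show "square_dipath (p \<circ> linepath c 1)" using c by (intro seg) auto
        fix t :: real assume "t \<in> {0..1}"
        then show "fst ((p \<circ> linepath c 1) t) \<ge> 1/2"
          using linepath_real_in[of c 1 t] c le[of c "linepath c 1 t"] by auto
      qed
      ultimately show ?thesis
        using D_unsplit[of c "L \<circ> p"] c by (simp add: comp_assoc)
    qed
  qed
  have "dimap2 D Y L"
    unfolding dimap2_alt
  proof (intro conjI allI impI)
    show "L ` ({0..1} \<times> {0..1}) \<subseteq> Y" using imL by auto
    fix p assume p: "square_dipath p"
    have "path_image (L \<circ> p) \<subseteq> Y"
    proof
      fix y assume "y \<in> path_image (L \<circ> p)"
      then obtain t where t: "t \<in> {0..1}" "y = L (p t)" by (auto simp: path_image_def)
      show "y \<in> Y" using imL[of "fst (p t)" "snd (p t)"] square_dipath_in[OF p t(1)] t(2) by simp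
    qed
    with DL[OF p] show "L \<circ> p \<in> dip D Y" by (simp add: dip_def)
  qed (rule contL)
  moreover have "L (t, 0) = (\<gamma> +++ \<delta>) t \<and> L (t, 1) = (\<gamma>' +++ \<delta>') t" if "t \<in> {0..1}" for t
    using that H K by (auto simp: L_def joinpaths_def)
  moreover have "L (0, s) = (\<gamma> +++ \<delta>) 0 \<and> L (1, s) = (\<gamma> +++ \<delta>) 1" if "s \<in> {0..1}" for s
    using that H K by (auto simp: L_def joinpaths_def)
  ultimately show ?thesis unfolding dhtp_def by blast
qed

text \<open>One factor is changed at a time: the links of the first zigzag are joined with the
  constant homotopy of \<delta>, then those of the second with the constant homotopy of
  \<open>\<gamma>'\<close>. Ends do not move along a zigzag, so all these joins are
  composable.\<close>

lemma equiv_join: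
  assumes 1: "equivclp (dhtp D Y) \<gamma> \<gamma>'" and 2: "equivclp (dhtp D Y) \<delta> \<delta>'"
    and "\<gamma> \<in> dip D Y" "\<delta> \<in> dip D Y" "\<gamma> 1 = \<delta> 0"
  shows "equivclp (dhtp D Y) (\<gamma> +++ \<delta>) (\<gamma>' +++ \<delta>')"
proof -
  have "equivclp (dhtp D Y) (\<gamma> +++ \<delta>) (\<gamma>' +++ \<delta>)"
    using 1
  proof (induction rule: equivclp_induct)
    case (step y z)
    have y: "y 1 = \<delta> 0" "z 1 = \<delta> 0"
      using equiv_dip[OF step(1) assms(3)] step(2) dhtp_dip assms(5) by metis+
    have "dhtp D Y \<delta> \<delta>" using dhtp_eq_on[OF assms(4)] by simp
    then have "dhtp D Y (y +++ \<delta>) (z +++ \<delta>) \<or> dhtp D Y (z +++ \<delta>) (y +++ \<delta>)"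
      using step(2) y dhtp_join by blast
    then show ?case using step.IH
      by (metis equivclp_sym equivclp_trans r_into_equivclp)
  qed (simp add: equivclp_def)
  moreover have \<gamma>': "\<gamma>' \<in> dip D Y" "\<gamma>' 1 = \<delta> 0"
    using equiv_dip[OF 1 assms(3)] assms(5) by auto
  have "equivclp (dhtp D Y) (\<gamma>' +++ \<delta>) (\<gamma>' +++ \<delta>')"
    using 2
  proof (induction rule: equivclp_induct)
    case (step y z)
    have y: "\<gamma>' 1 = y 0" "\<gamma>' 1 = z 0"
      using equiv_dip[OF step(1) assms(4)] step(2) dhtp_dip \<gamma>'(2) by metis+
    have "dhtp D Y \<gamma>' \<gamma>'" using dhtp_eq_on[OF \<gamma>'(1)] by simp
    then have "dhtp D Y (\<gamma>' +++ y) (\<gamma>' +++ z) \<or> dhtp D Y (\<gamma>' +++ z) (\<gamma>' +++ y)"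
      using step(2) y dhtp_join by blast
    then show ?case using step.IH
      by (metis equivclp_sym equivclp_trans r_into_equivclp)
  qed (simp add: equivclp_def)
  ultimately show ?thesis by (rule equivclp_trans)
qed

text \<open>The straight-line homotopy from p to q followed by \<open>H\<close>. Monotone paths with
  common ends, and their convex combinations, stay in the rectangle spanned by these ends; so only
  the image of that rectangle has to lie in \<open>Y\<close>, while \<open>H\<close> itself maps
  into \<open>X\<close>.\<close>

lemma dhtp_square_le:
  assumes H: "dimap2 D X H" and p: "square_dipath p" and q: "square_dipath q"
    and le: "\<And>t. t \<in> {0..1} \<Longrightarrow> fst (p t) \<le> fst (q t) \<and> snd (p t) \<le> snd (q t)"
    and ends: "p 0 = q 0" "p 1 = q 1"
    and Y: "H ` ({fst (p 0)..fst (p 1)} \<times> {snd (p 0)..snd (p 1)}) \<subseteq> Y"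
  shows "dhtp D Y (H \<circ> p) (H \<circ> q)"
proof -
  define m :: "real \<Rightarrow> real \<Rightarrow> real \<Rightarrow> real" where "m s x y = (1 - s) * x + s * y" for s x y
  \<comment> \<open>A convex combination grows with its weight s only if the second point is at
    least the first; the premise \<open>x' \<le> y'\<close> is where p below q is used.\<close>
  have m_mono: "m s x y \<le> m s' x' y'"
    if "x \<le> x'" "y \<le> y'" "s \<le> s'" "x' \<le> y'" "0 \<le> s" "s \<le> 1" for s s' x x' y y'
  proof -
    have "m s x y \<le> m s x' y'"
      unfolding m_def using that by (intro add_mono mult_left_mono) auto
    moreover have "m s' x' y' - m s x' y' = (s' - s) * (y' - x')"
      by (simp add: m_def algebra_simps)
    moreover have "(s' - s) * (y' - x') \<ge> 0" using that by simp
    ultimately show ?thesis by linarith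
  qed
  have m_in: "m s x y \<in> {a..b}" if "x \<in> {a..b}" "y \<in> {a..b}" "0 \<le> s" "s \<le> 1" for s x y a b
  proof -
    have "(1 - s) * a + s * a \<le> m s x y" "m s x y \<le> (1 - s) * b + s * b"
      unfolding m_def using that by (auto intro!: add_mono mult_left_mono)
    then show ?thesis by (simp add: algebra_simps)
  qed
  define r where "r x = (m (snd x) (fst (p (fst x))) (fst (q (fst x))),
                         m (snd x) (snd (p (fst x))) (snd (q (fst x))))" for x
  define Q where "Q = {fst (p 0)..fst (p 1)} \<times> {snd (p 0)..snd (p 1)}"
  have r_in: "r x \<in> Q" if "x \<in> {0..1} \<times> {0..1}" for x
  proof -
    have x: "fst x \<in> {0..1}" "0 \<le> snd x" "snd x \<le> 1" using that by (auto simp: mem_Times_iff)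
    then show ?thesis unfolding r_def Q_def mem_Times_iff fst_conv snd_conv
      using square_dipath_le[OF p, of 0 "fst x"] square_dipath_le[OF p, of "fst x" 1]
        square_dipath_le[OF q, of 0 "fst x"] square_dipath_le[OF q, of "fst x" 1] ends
      by (intro conjI m_in) auto
  qed
  have Q01: "Q \<subseteq> {0..1} \<times> {0..1}"
    using square_dipath_in[OF p, of 0] square_dipath_in[OF p, of 1] by (auto simp: Q_def)
  note pq = square_dipathD(1)[OF p] square_dipathD(1)[OF q]
  have cp: "continuous_on ({0..1} \<times> {0..1}) (\<lambda>x::real\<times>real. p (fst x))"
    by (rule continuous_on_compose2[OF pq(1)]) (auto intro!: continuous_intros)
  have cq: "continuous_on ({0..1} \<times> {0..1}) (\<lambda>x::real\<times>real. q (fst x))"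
    by (rule continuous_on_compose2[OF pq(2)]) (auto intro!: continuous_intros)
  have contr: "continuous_on ({0..1} \<times> {0..1}) r"
    unfolding r_def[abs_def] m_def by (intro continuous_intros cp cq)
  have "dimap2 D Y (H \<circ> r)"
    unfolding dimap2_alt
  proof (intro conjI allI impI)
    have "continuous_on ({0..1} \<times> {0..1}) H" using H unfolding dimap2_def by blast
    then have "continuous_on ({0..1} \<times> {0..1}) (\<lambda>x. H (r x))"
      by (rule continuous_on_compose2[OF _ contr]) (use r_in Q01 in blast)
    then show "continuous_on ({0..1} \<times> {0..1}) (H \<circ> r)" by (simp add: comp_def)
    show "(H \<circ> r) ` ({0..1} \<times> {0..1}) \<subseteq> Y"
      using r_in Y unfolding Q_def by fastforce
    fix z assume z: "square_dipath z"
    have zin: "z t \<in> {0..1} \<times> {0..1}" if "t \<in> {0..1}" for t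
      using square_dipath_in[OF z that] by (simp add: mem_Times_iff)
    have rz: "r (z t) \<in> Q" if "t \<in> {0..1}" for t
      using r_in[OF zin[OF that]] .
    have "square_dipath (r \<circ> z)"
      unfolding square_dipath_def
    proof (intro conjI)
      have "continuous_on {0..1} (\<lambda>t. r (z t))"
        by (rule continuous_on_compose2[OF contr square_dipathD(1)[OF z]]) (use zin in blast)
      then show "path (r \<circ> z)" by (simp add: path_def comp_def)
      show "path_image (r \<circ> z) \<subseteq> {0..1} \<times> {0..1}"
        unfolding path_image_def comp_def by (rule image_subsetI) (use rz Q01 in blast)
      show "mono_on {0..1} (fst \<circ> (r \<circ> z))" "mono_on {0..1} (snd \<circ> (r \<circ> z))"
        using square_dipath_in[OF z] square_dipath_le[OF z] square_dipath_le[OF p] square_dipath_le[OF q] le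
        by (simp_all add: mono_on_def r_def m_mono)
    qed
    then have "H \<circ> (r \<circ> z) \<in> dip D X" using H unfolding dimap2_alt by blast
    then have "H \<circ> r \<circ> z \<in> D" by (simp add: dip_def comp_assoc)
    moreover have "path_image (H \<circ> r \<circ> z) \<subseteq> Y"
      using rz Y unfolding Q_def path_image_def by fastforce
    ultimately show "H \<circ> r \<circ> z \<in> dip D Y" by (simp add: dip_def)
  qed
  moreover have "(H \<circ> r) (t, 0) = (H \<circ> p) t \<and> (H \<circ> r) (t, 1) = (H \<circ> q) t" for t
    by (simp add: r_def m_def)
  moreover have "(H \<circ> r) (0, s) = (H \<circ> p) 0 \<and> (H \<circ> r) (1, s) = (H \<circ> p) 1" for s
    using ends by (auto simp: r_def m_def algebra_simps)
  ultimately show ?thesis unfolding dhtp_def by blast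
qed

text \<open>Two dipaths of the square with the same ends need not be comparable, but both lie below
  their pointwise maximum.\<close>

lemma equiv_square:
  assumes H: "dimap2 D X H" and p: "square_dipath p" and q: "square_dipath q"
    and ends: "p 0 = q 0" "p 1 = q 1"
    and Y: "H ` ({fst (p 0)..fst (p 1)} \<times> {snd (p 0)..snd (p 1)}) \<subseteq> Y"
  shows "equivclp (dhtp D Y) (H \<circ> p) (H \<circ> q)"
proof -
  define r where "r t = (max (fst (p t)) (fst (q t)), max (snd (p t)) (snd (q t)))" for t
  have r: "square_dipath r"
    unfolding r_def[abs_def]
  proof (intro square_dipath_pairI continuous_on_max square_dipathD[OF p] square_dipathD[OF q])
    fix t :: real assume t: "t \<in> {0..1}"
    show "max (fst (p t)) (fst (q t)) \<in> {0..1}" "max (snd (p t)) (snd (q t)) \<in> {0..1}"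
      using square_dipath_in[OF p t] square_dipath_in[OF q t] by auto
  next
    show "mono_on {0..1} (\<lambda>t. max (fst (p t)) (fst (q t)))"
         "mono_on {0..1} (\<lambda>t. max (snd (p t)) (snd (q t)))"
      using square_dipath_le[OF p] square_dipath_le[OF q] by (intro mono_onI max.mono; simp)+
  qed
  have e: "p 0 = r 0" "p 1 = r 1" "q 0 = r 0" "q 1 = r 1"
    using ends by (auto simp: r_def)
  have pr: "dhtp D Y (H \<circ> p) (H \<circ> r)"
    by (rule dhtp_square_le[OF H p r _ e(1,2) Y]) (auto simp: r_def)
  have qr: "dhtp D Y (H \<circ> q) (H \<circ> r)"
    by (rule dhtp_square_le[OF H q r _ e(3,4)]) (use Y ends in \<open>auto simp: r_def\<close>)
  show ?thesis
    using equivclp_trans[OF r_into_equivclp[of "dhtp D Y", OF pr]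
        equivclp_sym[OF r_into_equivclp[of "dhtp D Y", OF qr]]] .
qed

text \<open>With \<gamma> seen as a homotopy that ignores its second variable, two
  reparametrizations become dipaths on the bottom edge of the square, and
  \<open>equiv_square\<close> applies. The condition on \<open>Y\<close> concerns only the stretch
  of \<gamma> actually travelled, since \<gamma> may leave \<open>Y\<close> elsewhere.\<close>

lemma equiv_reparam:
  assumes \<gamma>: "\<gamma> \<in> D" and \<phi>: "unit_dipath \<phi>" and \<psi>: "unit_dipath \<psi>"
    and ends: "\<phi> 0 = \<psi> 0" "\<phi> 1 = \<psi> 1" and Y: "\<gamma> ` {\<phi> 0..\<phi> 1} \<subseteq> Y"
  shows "equivclp (dhtp D Y) (\<gamma> \<circ> \<phi>) (\<gamma> \<circ> \<psi>)"
proof -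
  have sq: "square_dipath (\<lambda>t. (\<theta> t, 0))" if "unit_dipath \<theta>" for \<theta>
    using that unfolding unit_dipath_def
    by (intro square_dipath_pairI) (auto simp: mono_on_def image_subset_iff)
  have H: "dimap2 D X (\<lambda>x. \<gamma> (fst x))"
    using \<gamma> by (intro dimap2_path) (simp add: dip_space)
  have "equivclp (dhtp D Y) ((\<lambda>x. \<gamma> (fst x)) \<circ> (\<lambda>t. (\<phi> t, 0::real))) ((\<lambda>x. \<gamma> (fst x)) \<circ> (\<lambda>t. (\<psi> t, 0::real)))"
    by (intro equiv_square[OF H sq[OF \<phi>] sq[OF \<psi>]]) (use ends Y in auto)
  then show ?thesis by (simp add: comp_def)
qed

section \<open>The fundamental category\<close>

lemma dip_unit_dipath:
  assumes "\<gamma> \<in> dip D Y" "unit_dipath \<phi>"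
  shows "\<gamma> \<circ> \<phi> \<in> dip D Y"
proof -
  have "path_image (\<gamma> \<circ> \<phi>) \<subseteq> path_image \<gamma>"
    using assms(2) unfolding unit_dipath_def path_image_def by auto
  then show ?thesis
    using assms D_reparam unfolding dip_def unit_dipath_def by auto
qed

text \<open>Going from u to w with or without a stop at v gives two reparametrizations with the same
  ends. This is how subdivision points are inserted and removed later.\<close>

lemma equiv_linepath_join:
  assumes "\<gamma> \<in> D" "\<gamma> ` {u..w} \<subseteq> Y" "0 \<le> u" "u \<le> v" "v \<le> w" "w \<le> 1"
  shows "equivclp (dhtp D Y) ((\<gamma> \<circ> linepath u v) +++ (\<gamma> \<circ> linepath v w)) (\<gamma> \<circ> linepath u w)"
proof -
  have "equivclp (dhtp D Y) (\<gamma> \<circ> (linepath u v +++ linepath v w)) (\<gamma> \<circ> linepath u w)"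
    using assms by (intro equiv_reparam unit_dipath_join unit_dipath_linepath)
      (simp_all add: joinpaths_def linepath_real)
  then show ?thesis by (simp add: path_compose_join)
qed

text \<open>These are the degenerate subdivisions of \<open>{0..1}\<close> at 0 and at 1, where one
  of the two segments is constant.\<close>

lemma equiv_const_join:
  assumes "\<gamma> \<in> dip D Y"
  shows "equivclp (dhtp D Y) ((\<lambda>t. \<gamma> 0) +++ \<gamma>) \<gamma>" "equivclp (dhtp D Y) (\<gamma> +++ (\<lambda>t. \<gamma> 1)) \<gamma>"
proof -
  have id: "\<gamma> \<circ> linepath 0 1 = \<gamma>" "\<gamma> \<circ> linepath 0 0 = (\<lambda>t. \<gamma> 0)" "\<gamma> \<circ> linepath 1 1 = (\<lambda>t. \<gamma> 1)"
    by (simp_all add: fun_eq_iff linepath_real)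
  have "\<gamma> \<in> D" "\<gamma> ` {0..1} \<subseteq> Y" using assms unfolding dip_def path_image_def by auto
  note join = equiv_linepath_join[OF this]
  show "equivclp (dhtp D Y) ((\<lambda>t. \<gamma> 0) +++ \<gamma>) \<gamma>" "equivclp (dhtp D Y) (\<gamma> +++ (\<lambda>t. \<gamma> 1)) \<gamma>"
    using join[of 0] join[of 1]
    by (simp_all add: id)
qed

lemma equiv_join_assoc:
  assumes "\<gamma> \<in> dip D Y" "\<delta> \<in> dip D Y" "\<epsilon> \<in> dip D Y" "\<gamma> 1 = \<delta> 0" "\<delta> 1 = \<epsilon> 0"
  shows "equivclp (dhtp D Y) (\<gamma> +++ (\<delta> +++ \<epsilon>)) ((\<gamma> +++ \<delta>) +++ \<epsilon>)"
proof -
  define \<kappa> where "\<kappa> = (\<gamma> +++ \<delta>) +++ \<epsilon>"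
  \<comment> \<open>In \<open>\<kappa>\<close> the three factors occupy \<open>{0..1/4}\<close>,
    \<open>{1/4..1/2}\<close> and \<open>{1/2..1}\<close>; in the other bracketing they end at 1/2,
    3/4 and 1. The map \<open>?\<phi>\<close> runs through the former blocks on the schedule of the
    latter.\<close>
  let ?\<phi> = "linepath 0 (1/4) +++ (linepath (1/4) (1/2) +++ linepath (1/2) (1::real))"
  have "\<gamma> +++ \<delta> \<in> dip D Y" using assms by (intro dip_join)
  then have \<kappa>: "\<kappa> \<in> dip D Y"
    unfolding \<kappa>_def using assms by (intro dip_join) (auto simp: joinpaths_def)
  have \<phi>: "unit_dipath ?\<phi>"
    by (intro unit_dipath_join unit_dipath_linepath) (simp_all add: joinpaths_def linepath_real)
  have 1: "equivclp (dhtp D Y) (\<kappa> \<circ> ?\<phi>) (\<kappa> \<circ> linepath 0 1)"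
    using \<kappa> by (intro equiv_reparam \<phi> unit_dipath_linepath)
      (auto simp: joinpaths_def linepath_real dip_def path_image_def)
  have 2: "\<kappa> \<circ> linepath 0 1 = \<kappa>"
    by (simp add: fun_eq_iff linepath_real)
  have 3: "dhtp D Y (\<kappa> \<circ> ?\<phi>) (\<gamma> +++ (\<delta> +++ \<epsilon>))"
  proof (rule dhtp_eq_on[OF dip_unit_dipath[OF \<kappa> \<phi>]])
    have 1: "\<kappa> (linepath 0 (1/4) t) = \<gamma> t" "\<kappa> (linepath (1/4) (1/2) t) = \<delta> t"
      "\<kappa> (linepath (1/2) 1 t) = \<epsilon> t" if "t \<in> {0..1}" for t
      using that assms(4,5)
      by (cases "t = 0"; auto simp: \<kappa>_def joinpaths_def linepath_real field_simps)+
    fix t :: real assume t: "t \<in> {0..1}"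
    consider "t \<le> 1/2" | "1/2 < t" "t \<le> 3/4" | "t > 3/4" by linarith
    then show "(\<gamma> +++ (\<delta> +++ \<epsilon>)) t = (\<kappa> \<circ> ?\<phi>) t"
      using t 1(1)[of "2 * t"] 1(2)[of "2 * (2 * t - 1)"] 1(3)[of "2 * (2 * t - 1) - 1"]
      by cases (simp_all add: joinpaths_def)
  qed
  show ?thesis
    using equivclp_trans[OF equivclp_sym[OF r_into_equivclp[of "dhtp D Y", OF 3]] 1]
    by (simp only: 2 \<kappa>_def[symmetric])
qed

section \<open>Arrows as classes of dipaths\<close>

definition mor :: "'a set \<Rightarrow> (real \<Rightarrow> 'a) \<Rightarrow> 'a dmor" where
  "mor Y \<gamma> = (\<gamma> 0, \<gamma> 1, dcls D Y \<gamma>)"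

lemma mor_ends [simp]: "fst (mor Y \<gamma>) = \<gamma> 0" "fst (snd (mor Y \<gamma>)) = \<gamma> 1"
  by (simp_all add: mor_def)

lemma dcls_eq: "equivclp (dhtp D Y) \<gamma> \<delta> \<Longrightarrow> dcls D Y \<gamma> = dcls D Y \<delta>"
  unfolding dcls_def by (blast intro: equivclp_trans equivclp_sym)

lemma mor_eq:
  "equivclp (dhtp D Y) \<gamma> \<delta> \<Longrightarrow> \<gamma> \<in> dip D Y \<Longrightarrow> mor Y \<gamma> = mor Y \<delta>"
  using dcls_eq equiv_dip unfolding mor_def by metis

text \<open>\<open>rep\<close> is an arbitrary choice; being dihomotopic to a known dipath of the
  class is what allows it to be eliminated from composition, inclusions and the glued
  functor.\<close>

lemma rep_mor: "equivclp (dhtp D Y) \<gamma> (rep (mor Y \<gamma>))"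
proof -
  have "\<gamma> \<in> dcls D Y \<gamma>" by (simp add: dcls_def equivclp_def)
  then have "rep (mor Y \<gamma>) \<in> dcls D Y \<gamma>"
    unfolding rep_def mor_def by (simp add: someI_ex[of "\<lambda>\<delta>. \<delta> \<in> dcls D Y \<gamma>"] exI[of _ \<gamma>])
  then show ?thesis by (simp add: dcls_def)
qed

lemma Obj_fcat [simp]: "Obj (fcat D Y A) = A"
  and Dom_fcat [simp]: "Dom (fcat D Y A) f = fst f"
  and Cod_fcat [simp]: "Cod (fcat D Y A) f = fst (snd f)"
  and Id_fcat: "Id (fcat D Y A) a = mor Y (\<lambda>t. a)"
  by (simp_all add: fcat_def mor_def)

lemma Arr_fcat: "f \<in> Arr (fcat D Y A) \<longleftrightarrow> (\<exists>\<gamma>\<in>dip D Y. \<gamma> 0 \<in> A \<and> \<gamma> 1 \<in> A \<and> f = mor Y \<gamma>)"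
  by (auto simp: fcat_def mor_def)

text \<open>Composition ignores the set of objects, so equations may be computed with all points as
  objects and read in a full subcategory.\<close>

lemma Comp_fcat_indep: "Comp (fcat D Y A) = Comp (fcat D Y A')"
  by (simp add: fcat_def)

text \<open>The chosen representatives can be exchanged for \<gamma> and \<delta> because
  concatenation respects dihomotopy in both factors.\<close>

lemma Comp_fcat:
  assumes "\<gamma> \<in> dip D Y" "\<delta> \<in> dip D Y" "\<gamma> 1 = \<delta> 0"
  shows "Comp (fcat D Y A) (mor Y \<delta>) (mor Y \<gamma>) = mor Y (\<gamma> +++ \<delta>)"
proof -
  have "equivclp (dhtp D Y) (\<gamma> +++ \<delta>) (rep (mor Y \<gamma>) +++ rep (mor Y \<delta>))"
    by (rule equiv_join[OF rep_mor rep_mor assms])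
  then have "dcls D Y (rep (mor Y \<gamma>) +++ rep (mor Y \<delta>)) = dcls D Y (\<gamma> +++ \<delta>)"
    using dcls_eq by metis
  then show ?thesis
    by (simp add: fcat_def) (simp add: mor_def joinpaths_def)
qed

text \<open>The representative chosen by \<open>rep\<close> is linked to \<gamma> by a zigzag in
  \<open>Y\<close>, which is also one in \<open>Z\<close>.\<close>

lemma incl_mor:
  assumes "\<gamma> \<in> dip D Y" "Y \<subseteq> Z"
  shows "snd (incl D Z) (mor Y \<gamma>) = mor Z \<gamma>"
proof -
  have "equivclp (dhtp D Z) \<gamma> (rep (mor Y \<gamma>))"
    using rep_mor by (rule equivclp_mono_rel) (use assms(2) dhtp_mono in blast)
  then have "dcls D Z (rep (mor Y \<gamma>)) = dcls D Z \<gamma>"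
    using dcls_eq by metis
  then show ?thesis by (simp add: incl_def) (simp add: mor_def)
qed

lemma incl_obj [simp]: "fst (incl D Z) x = x"
  by (simp add: incl_def)

lemma category_fcat:
  assumes "A \<subseteq> Y" "Y \<subseteq> X"
  shows "category (fcat D Y A)"
  unfolding category_def
proof (intro conjI ballI impI)
  fix f assume "f \<in> Arr (fcat D Y A)"
  then obtain \<gamma> where f: "\<gamma> \<in> dip D Y" "\<gamma> 0 \<in> A" "\<gamma> 1 \<in> A" "f = mor Y \<gamma>"
    unfolding Arr_fcat by blast
  show "Dom (fcat D Y A) f \<in> Obj (fcat D Y A)" "Cod (fcat D Y A) f \<in> Obj (fcat D Y A)"
    using f by auto
  have c: "(\<lambda>t. \<gamma> 0) \<in> dip D Y" "(\<lambda>t. \<gamma> 1) \<in> dip D Y"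
    using f assms by (auto intro: dip_const)
  have "mor Y ((\<lambda>t. \<gamma> 0) +++ \<gamma>) = mor Y \<gamma>" "mor Y (\<gamma> +++ (\<lambda>t. \<gamma> 1)) = mor Y \<gamma>"
    using c f by (auto intro!: mor_eq equiv_const_join dip_join assms)
  then show "Comp (fcat D Y A) (Id (fcat D Y A) (Cod (fcat D Y A) f)) f = f"
    "Comp (fcat D Y A) f (Id (fcat D Y A) (Dom (fcat D Y A) f)) = f"
    using c f by (simp_all add: Id_fcat Comp_fcat)
next
  fix x assume "x \<in> Obj (fcat D Y A)"
  then have "(\<lambda>t. x) \<in> dip D Y" "x \<in> A" using assms by (auto intro: dip_const)
  then show "Id (fcat D Y A) x \<in> hom (fcat D Y A) x x"
    by (auto simp: Id_fcat hom_def Arr_fcat)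
next
  fix f g assume "f \<in> Arr (fcat D Y A)" "g \<in> Arr (fcat D Y A)"
    and e: "Dom (fcat D Y A) g = Cod (fcat D Y A) f"
  then obtain \<gamma> \<delta> where f: "\<gamma> \<in> dip D Y" "\<gamma> 0 \<in> A" "\<gamma> 1 \<in> A" "f = mor Y \<gamma>"
    and g: "\<delta> \<in> dip D Y" "\<delta> 0 \<in> A" "\<delta> 1 \<in> A" "g = mor Y \<delta>"
    unfolding Arr_fcat by blast
  have e: "\<gamma> 1 = \<delta> 0" using e f g by simp
  then have "\<gamma> +++ \<delta> \<in> dip D Y" "(\<gamma> +++ \<delta>) 0 = \<gamma> 0" "(\<gamma> +++ \<delta>) 1 = \<delta> 1"
    using dip_join f g by (auto simp: joinpaths_def)
  then show "Comp (fcat D Y A) g f \<in> hom (fcat D Y A) (Dom (fcat D Y A) f) (Cod (fcat D Y A) g)"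
    using f g e by (auto simp: Comp_fcat hom_def Arr_fcat intro!: bexI[of _ "\<gamma> +++ \<delta>"])
next
  fix f g h assume "f \<in> Arr (fcat D Y A)" "g \<in> Arr (fcat D Y A)" "h \<in> Arr (fcat D Y A)"
    and e: "Dom (fcat D Y A) g = Cod (fcat D Y A) f \<and> Dom (fcat D Y A) h = Cod (fcat D Y A) g"
  then obtain \<gamma> \<delta> \<epsilon> where f: "\<gamma> \<in> dip D Y" "f = mor Y \<gamma>" "\<delta> \<in> dip D Y" "g = mor Y \<delta>"
    "\<epsilon> \<in> dip D Y" "h = mor Y \<epsilon>"
    unfolding Arr_fcat by blast
  have e: "\<gamma> 1 = \<delta> 0" "\<delta> 1 = \<epsilon> 0" using e f by simp_all
  have "\<gamma> +++ \<delta> \<in> dip D Y" "\<delta> +++ \<epsilon> \<in> dip D Y" "(\<gamma> +++ \<delta>) 1 = \<delta> 1" "(\<delta> +++ \<epsilon>) 0 = \<delta> 0"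
    using dip_join f e by (auto simp: joinpaths_def)
  moreover from this have "mor Y (\<gamma> +++ (\<delta> +++ \<epsilon>)) = mor Y ((\<gamma> +++ \<delta>) +++ \<epsilon>)"
    using f e by (intro mor_eq equiv_join_assoc assms dip_join) auto
  ultimately show "Comp (fcat D Y A) h (Comp (fcat D Y A) g f) = Comp (fcat D Y A) (Comp (fcat D Y A) h g) f"
    using f e by (simp add: Comp_fcat)
qed

end

section \<open>Subordinate subdivisions\<close>

lemma hom_comp: "category C \<Longrightarrow> f \<in> hom C x y \<Longrightarrow> g \<in> hom C y z \<Longrightarrow> Comp C g f \<in> hom C x z"
  unfolding category_def hom_def by force

lemma hom_Id: "category C \<Longrightarrow> x \<in> Obj C \<Longrightarrow> Id C x \<in> hom C x x"
  unfolding category_def by blast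

lemma hom_obj: "category C \<Longrightarrow> f \<in> hom C x y \<Longrightarrow> x \<in> Obj C \<and> y \<in> Obj C"
  unfolding category_def hom_def by blast

lemma hom_Id_left: "category C \<Longrightarrow> f \<in> hom C x y \<Longrightarrow> Comp C (Id C y) f = f"
  and hom_Id_right: "category C \<Longrightarrow> f \<in> hom C x y \<Longrightarrow> Comp C f (Id C x) = f"
  unfolding category_def hom_def by auto

lemma hom_assoc:
  "category C \<Longrightarrow> f \<in> hom C x y \<Longrightarrow> g \<in> hom C y z \<Longrightarrow> h \<in> hom C z w \<Longrightarrow>
    Comp C h (Comp C g f) = Comp C (Comp C h g) f"
  unfolding category_def hom_def by auto

lemma openin_relint: "openin (top_of_set S) (relint S T)"
  unfolding relint_def by (rule openin_Union) blast

lemma relint_subset: "relint S T \<subseteq> T"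
  unfolding relint_def by blast

lemma linepath_image_real: "u \<le> v \<Longrightarrow> linepath u v ` {0..1} = {u..v}" for u v :: real
  using path_image_linepath[of u v] by (simp add: path_image_def closed_segment_eq_real_ivl)

lemma joinpaths_halves:
  assumes "y \<in> {0..1}" "\<gamma> 1 = \<delta> 0"
  shows "(\<gamma> +++ \<delta>) (y / 2) = \<gamma> y" "(\<gamma> +++ \<delta>) ((1 + y) / 2) = \<delta> y"
proof -
  show "(\<gamma> +++ \<delta>) (y / 2) = \<gamma> y"
    using assms by (simp add: joinpaths_def)
  show "(\<gamma> +++ \<delta>) ((1 + y) / 2) = \<delta> y"
    using assms by (cases "y = 0") (simp_all add: joinpaths_def add_divide_distrib)
qed

lemma frac_bounds: "i < n \<Longrightarrow> 0 \<le> real i / real n \<and> real i / real n \<le> real (Suc i) / real n \<and> real (Suc i) / real n \<le> 1"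
  by (auto simp: divide_simps)

lemma frac_interval: "i < n \<Longrightarrow> {real i / real n..real (Suc i) / real n} \<subseteq> {0..1}"
  unfolding atLeastatMost_subset_iff using frac_bounds by blast

lemma linepath_frac_in:
  assumes "i < n" "t \<in> {0..1}"
  shows "linepath (real i / n) (real (Suc i) / n) t \<in> {0..1}"
proof -
  have "linepath (real i / n) (real (Suc i) / n) t \<in> {real i / n..real (Suc i) / n}"
    using frac_bounds[OF assms(1)] assms(2) by (intro linepath_real_in) auto
  then show ?thesis using frac_interval[OF assms(1)] by blast
qed

text \<open>Keeping the cover as a family lets both parts of the space be treated by one argument.
  That already the relative interiors cover \<open>X\<close> is what yields a Lebesgue number
  below.\<close>

locale covered_space = directed_space X D
  for X :: "'a::topological_space set" and D +
  fixes \<U> :: "'a set set"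
  assumes cover: "X = (\<Union>U\<in>\<U>. relint X U)" and cover_subset: "U \<in> \<U> \<Longrightarrow> U \<subseteq> X"
begin

lemma in_cover: "x \<in> X \<Longrightarrow> \<exists>U\<in>\<U>. x \<in> U"
  using cover relint_subset by blast

text \<open>The preimages of the relative interiors form an open cover of the compact square; a grid
  that is fine compared with its Lebesgue number has the property.\<close>

lemma grid_subordinate:
  assumes cont: "continuous_on ({0..1} \<times> {0..1}) H" and im: "H ` ({0..1} \<times> {0..1}) \<subseteq> X"
  obtains n :: nat where "0 < n" "\<And>i j. i < n \<Longrightarrow> j < n \<Longrightarrow>
    \<exists>U\<in>\<U>. H ` ({real i / n..real (Suc i) / n} \<times> {real j / n..real (Suc j) / n}) \<subseteq> U"
proof -
  define S :: "(real \<times> real) set" where "S = {0..1} \<times> {0..1}"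
  \<comment> \<open>Preimages are open only relative to the square, while the covering lemma asks
    for open sets of the plane; hence the intersection with \<open>S\<close>.\<close>
  define \<G> where "\<G> = {G. open G \<and> (\<exists>U\<in>\<U>. H ` (S \<inter> G) \<subseteq> U)}"
  have "S \<subseteq> \<Union>\<G>"
  proof
    fix x assume x: "x \<in> S"
    then have "H x \<in> X" using im by (auto simp: S_def)
    then obtain U where U: "U \<in> \<U>" "H x \<in> relint X U" using cover by blast
    have "openin (top_of_set S) (S \<inter> H -` relint X U)"
      by (rule continuous_openin_preimage[OF _ _ openin_relint]) (use cont im in \<open>auto simp: S_def\<close>)
    then obtain G where G: "open G" "S \<inter> H -` relint X U = S \<inter> G"
      unfolding openin_open by blast
    then have "H ` (S \<inter> G) \<subseteq> U" using relint_subset by blast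
    then have "G \<in> \<G>" using G U by (auto simp: \<G>_def)
    moreover have "x \<in> G" using G x U by blast
    ultimately show "x \<in> \<Union>\<G>" by blast
  qed
  moreover have "compact S" unfolding S_def by (intro compact_Times) auto
  ultimately obtain \<epsilon> where \<epsilon>: "0 < \<epsilon>" "\<And>x. x \<in> S \<Longrightarrow> \<exists>G\<in>\<G>. ball x \<epsilon> \<subseteq> G"
    using Heine_Borel_lemma[of S \<G>] unfolding \<G>_def by blast
  \<comment> \<open>The factor 2 comes from bounding the distance to the lower left corner of a cell
    by the sum of the two coordinate differences, each at most 1/n.\<close>
  obtain n :: nat where n: "2 / \<epsilon> < n" using reals_Archimedean2 by blast
  have n0: "0 < n" using n \<epsilon>(1) by (metis divide_pos_pos gr0I of_nat_0 order_less_asym zero_less_numeral)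
  have n2: "2 / n < \<epsilon>" using n n0 \<epsilon>(1) by (simp add: field_simps)
  have "\<exists>U\<in>\<U>. H ` ({real i / n..real (Suc i) / n} \<times> {real j / n..real (Suc j) / n}) \<subseteq> U"
    if ij: "i < n" "j < n" for i j
  proof -
    let ?Q = "{real i / n..real (Suc i) / n} \<times> {real j / n..real (Suc j) / n}"
    have "(real i / n, real j / n) \<in> S" using ij by (simp add: S_def)
    then obtain G where G: "G \<in> \<G>" "ball (real i / n, real j / n) \<epsilon> \<subseteq> G" using \<epsilon>(2) by blast
    have QS: "?Q \<subseteq> S"
      using frac_bounds[OF ij(1)] frac_bounds[OF ij(2)] unfolding S_def
      by (intro Sigma_mono) auto
    have "?Q \<subseteq> ball (real i / n, real j / n) \<epsilon>"
    proof
      fix z assume z: "z \<in> ?Q"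
      have split: "real (Suc k) / n = real k / n + 1 / n" for k by (simp add: add_divide_distrib)
      have "\<bar>real i / n - fst z\<bar> \<le> 1 / n" "\<bar>real j / n - snd z\<bar> \<le> 1 / n"
        using z unfolding mem_Times_iff split by auto
      moreover have "dist (real i / n, real j / n) z \<le> \<bar>real i / n - fst z\<bar> + \<bar>real j / n - snd z\<bar>"
        unfolding dist_prod_def dist_real_def fst_conv snd_conv
        using sqrt_sum_squares_le_sum_abs[of "\<bar>real i / n - fst z\<bar>" "\<bar>real j / n - snd z\<bar>"] by simp
      ultimately show "z \<in> ball (real i / n, real j / n) \<epsilon>" using n2 by simp
    qed
    then have "?Q \<subseteq> S \<inter> G" using QS G(2) by blast
    moreover obtain U where "U \<in> \<U>" "H ` (S \<inter> G) \<subseteq> U" using G(1) by (auto simp: \<G>_def)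
    ultimately show ?thesis by blast
  qed
  then show ?thesis using that n0 by blast
qed

lemma D_segment:
  assumes "\<gamma> \<in> D" "0 \<le> u" "u \<le> v" "v \<le> 1"
  shows "\<gamma> \<circ> linepath u v \<in> D"
  using assms by (intro D_reparam unit_dipath_linepath)

lemma dip_segment:
  assumes "\<gamma> \<in> D" "0 \<le> u" "u \<le> v" "v \<le> 1" "\<gamma> ` {u..v} \<subseteq> Y"
  shows "\<gamma> \<circ> linepath u v \<in> dip D Y"
proof -
  have "path_image (\<gamma> \<circ> linepath u v) = \<gamma> ` {u..v}"
    unfolding path_image_def image_comp[symmetric] linepath_image_real[OF assms(3)] ..
  then show ?thesis using assms D_segment by (simp add: dip_def)
qed

definition subordinate :: "nat \<Rightarrow> (real \<Rightarrow> 'a) \<Rightarrow> bool" where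
  "subordinate n \<gamma> \<longleftrightarrow> \<gamma> \<in> D \<and> 0 < n \<and> (\<forall>i<n. \<exists>U\<in>\<U>. \<gamma> ` {real i / n..real (Suc i) / n} \<subseteq> U)"

text \<open>A dipath is a homotopy constant in the second variable, and the lowest row of cells of
  its grid gives the subdivision.\<close>

lemma subordinate_exists:
  assumes "\<gamma> \<in> D"
  shows "\<exists>n. subordinate n \<gamma>"
proof -
  have "dimap2 D X (\<lambda>x. \<gamma> (fst x))"
    using assms by (intro dimap2_path) (simp add: dip_space)
  then obtain n :: nat where n: "0 < n" "\<And>i j. i < n \<Longrightarrow> j < n \<Longrightarrow>
    \<exists>U\<in>\<U>. (\<lambda>x. \<gamma> (fst x)) ` ({real i / n..real (Suc i) / n} \<times> {real j / n..real (Suc j) / n}) \<subseteq> U"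
    unfolding dimap2_def using grid_subordinate by blast
  have "\<exists>U\<in>\<U>. \<gamma> ` {real i / n..real (Suc i) / n} \<subseteq> U" if i: "i < n" for i
  proof -
    obtain U where U: "U \<in> \<U>"
      "(\<lambda>x. \<gamma> (fst x)) ` ({real i / n..real (Suc i) / n} \<times> {real 0 / n..real (Suc 0) / n}) \<subseteq> U"
      using n(2)[OF i n(1)] by blast
    have "\<gamma> t \<in> U" if "t \<in> {real i / n..real (Suc i) / n}" for t
      using U(2) that n(1) by (auto simp: image_subset_iff)
    then show ?thesis using U(1) by blast
  qed
  then show ?thesis using assms n(1) unfolding subordinate_def by blast
qed

text \<open>The fine piece i is contained in the coarse piece \<open>i div k\<close>.\<close>

lemma subordinate_mult:
  assumes "subordinate n \<gamma>" "0 < k"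
  shows "subordinate (n * k) \<gamma>"
  unfolding subordinate_def
proof (intro conjI allI impI)
  fix i assume i: "i < n * k"
  have "i div k < n" using i by (simp add: less_mult_imp_div_less)
  then obtain U where U: "U \<in> \<U>" "\<gamma> ` {real (i div k) / n..real (Suc (i div k)) / n} \<subseteq> U"
    using assms(1) unfolding subordinate_def by blast
  have "i div k * k \<le> i" "Suc i \<le> Suc (i div k) * k"
    using assms(2) by (auto simp: Suc_le_eq dividend_less_div_times add.commute)
  then have "real (i div k) * k \<le> real i" "real (Suc i) \<le> real (Suc (i div k)) * k"
    by (metis of_nat_le_iff of_nat_mult)+
  moreover have "0 < n" using assms(1) by (simp add: subordinate_def)
  ultimately have "real (i div k) / n \<le> real i / real (n * k)"
    "real (Suc i) / real (n * k) \<le> real (Suc (i div k)) / n"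
    using assms(2) by (simp_all add: divide_simps ac_simps del: of_nat_Suc)
  then have "{real i / real (n * k)..real (Suc i) / real (n * k)} \<subseteq> {real (i div k) / n..real (Suc (i div k)) / n}"
    by auto
  then show "\<exists>U\<in>\<U>. \<gamma> ` {real i / real (n * k)..real (Suc i) / real (n * k)} \<subseteq> U"
    using U by blast
qed (use assms in \<open>auto simp: subordinate_def\<close>)

text \<open>With the same n for both factors, the midpoint of the concatenation is one of its 2n + 1
  cut points, so no piece straddles it.\<close>

lemma subordinate_join:
  assumes \<gamma>: "subordinate n \<gamma>" and \<delta>: "subordinate n \<delta>" and e: "\<gamma> 1 = \<delta> 0"
  shows "subordinate (2 * n) (\<gamma> +++ \<delta>)"
  unfolding subordinate_def
proof (intro conjI allI impI)
  have n: "0 < n" using \<gamma> by (simp add: subordinate_def)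
  fix i assume i: "i < 2 * n"
  show "\<exists>U\<in>\<U>. (\<gamma> +++ \<delta>) ` {real i / real (2 * n)..real (Suc i) / real (2 * n)} \<subseteq> U"
  proof (cases "i < n")
    case True
    then obtain U where U: "U \<in> \<U>" "\<gamma> ` {real i / n..real (Suc i) / n} \<subseteq> U"
      using \<gamma> unfolding subordinate_def by blast
    have "(\<gamma> +++ \<delta>) t \<in> U" if t: "t \<in> {real i / real (2 * n)..real (Suc i) / real (2 * n)}" for t
    proof -
      have "2 * t \<in> {real i / n..real (Suc i) / n}" using t n by (simp add: field_simps)
      then show ?thesis
        using joinpaths_halves(1)[of "2 * t" \<gamma> \<delta>] e U(2) frac_bounds[OF True] by (auto simp del: of_nat_Suc)
    qed
    then show ?thesis using U(1) by blast
  next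
    case False
    define j where "j = i - n"
    have j: "i = n + j" "j < n" using False i by (auto simp: j_def)
    then obtain U where U: "U \<in> \<U>" "\<delta> ` {real j / n..real (Suc j) / n} \<subseteq> U"
      using \<delta> unfolding subordinate_def by blast
    have "(\<gamma> +++ \<delta>) t \<in> U" if t: "t \<in> {real i / real (2 * n)..real (Suc i) / real (2 * n)}" for t
    proof -
      have "2 * t - 1 \<in> {real j / n..real (Suc j) / n}" using t n by (simp add: field_simps j)
      then show ?thesis
        using joinpaths_halves(2)[of "2 * t - 1" \<gamma> \<delta>] e U(2) frac_bounds[OF j(2)] by (auto simp del: of_nat_Suc)
    qed
    then show ?thesis using U(1) by blast
  qed
qed (use assms D_join in \<open>auto simp: subordinate_def\<close>)

text \<open>The induction runs over initial segments ending at cut points. An initial segment joined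
  with the next piece is only dihomotopic to the longer initial segment, which is why
  \<open>Q\<close> has to respect dihomotopy.\<close>

lemma dipath_cover_induct:
  assumes \<gamma>: "\<gamma> \<in> D"
    and small: "\<And>U \<gamma>. U \<in> \<U> \<Longrightarrow> \<gamma> \<in> dip D U \<Longrightarrow> Q \<gamma>"
    and join: "\<And>\<gamma> \<delta>. \<gamma> \<in> D \<Longrightarrow> \<delta> \<in> D \<Longrightarrow> \<gamma> 1 = \<delta> 0 \<Longrightarrow> Q \<gamma> \<Longrightarrow> Q \<delta> \<Longrightarrow> Q (\<gamma> +++ \<delta>)"
    and equiv: "\<And>\<gamma> \<delta>. equivclp (dhtp D X) \<gamma> \<delta> \<Longrightarrow> \<gamma> \<in> D \<Longrightarrow> Q \<gamma> \<Longrightarrow> Q \<delta>"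
  shows "Q \<gamma>"
proof -
  obtain n where n: "subordinate n \<gamma>" using subordinate_exists[OF \<gamma>] by blast
  have "Q (\<gamma> \<circ> linepath 0 (real m / n))" if "m \<le> n" for m
    using that
  proof (induction m)
    case 0
    have x: "\<gamma> 0 \<in> X" using D_image[OF \<gamma>] by (auto simp: path_image_def)
    then obtain U where U: "U \<in> \<U>" "\<gamma> 0 \<in> U" using in_cover by blast
    have "(\<lambda>t. \<gamma> 0) \<in> dip D U" using U cover_subset by (intro dip_const)
    then have "Q (\<lambda>t. \<gamma> 0)" using small U by blast
    then show ?case by (simp add: comp_def linepath_real)
  next
    case (Suc m)
    then have m: "m < n" by simp
    let ?a = "real m / n" and ?b = "real (Suc m) / n"
    note b = frac_bounds[OF m]
    obtain U where U: "U \<in> \<U>" "\<gamma> ` {?a..?b} \<subseteq> U" using n m unfolding subordinate_def by blast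
    have "\<gamma> \<circ> linepath ?a ?b \<in> dip D U" using b U(2) by (intro dip_segment[OF \<gamma>]) auto
    then have "Q (\<gamma> \<circ> linepath ?a ?b)" using small U(1) by blast
    moreover have "\<gamma> \<circ> linepath 0 ?a \<in> D" "\<gamma> \<circ> linepath ?a ?b \<in> D"
      using b by (intro D_segment[OF \<gamma>]; simp)+
    moreover have "(\<gamma> \<circ> linepath 0 ?a) 1 = (\<gamma> \<circ> linepath ?a ?b) 0"
      by (simp add: linepath_1' linepath_0')
    moreover have "Q (\<gamma> \<circ> linepath 0 ?a)"
      by (rule Suc.IH) (use m in simp)
    ultimately have Q: "Q ((\<gamma> \<circ> linepath 0 ?a) +++ (\<gamma> \<circ> linepath ?a ?b))"
      "(\<gamma> \<circ> linepath 0 ?a) +++ (\<gamma> \<circ> linepath ?a ?b) \<in> D"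
      by (blast intro: join D_join)+
    have "\<gamma> ` {0..?b} \<subseteq> X" using b D_image[OF \<gamma>] by (auto simp: path_image_def)
    then show ?case
      using b by (intro equiv[OF equiv_linepath_join Q(2,1)] \<gamma>) auto
  qed
  from this[of n] have "Q (\<gamma> \<circ> linepath 0 1)" using n by (simp add: subordinate_def)
  moreover have "\<gamma> \<circ> linepath 0 1 = \<gamma>" by (simp add: fun_eq_iff linepath_real)
  ultimately show ?thesis by simp
qed

end

section \<open>Gluing functors\<close>

text \<open>A compatible family of functors on the members of the cover, recorded as single
  functions of points and dipaths, so that agreement on overlaps is built in. Homotopy invariance is
  assumed inside one member only; extending it to homotopies in \<open>X\<close> is the main
  task.\<close>

locale local_functor = covered_space X D \<U>
  for X :: "'a::topological_space set" and D \<U> +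
  fixes E :: "('o, 'm) cat" and ob :: "'a \<Rightarrow> 'o" and g :: "(real \<Rightarrow> 'a) \<Rightarrow> 'm"
  assumes E: "category E"
    and g_hom: "U \<in> \<U> \<Longrightarrow> \<gamma> \<in> dip D U \<Longrightarrow> g \<gamma> \<in> hom E (ob (\<gamma> 0)) (ob (\<gamma> 1))"
    and g_dhtp: "U \<in> \<U> \<Longrightarrow> dhtp D U \<gamma> \<delta> \<Longrightarrow> g \<gamma> = g \<delta>"
    and g_join: "U \<in> \<U> \<Longrightarrow> \<gamma> \<in> dip D U \<Longrightarrow> \<delta> \<in> dip D U \<Longrightarrow> \<gamma> 1 = \<delta> 0 \<Longrightarrow>
      g (\<gamma> +++ \<delta>) = Comp E (g \<delta>) (g \<gamma>)"
    and g_const: "x \<in> X \<Longrightarrow> g (\<lambda>t. x) = Id E (ob x)"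
begin

section \<open>Values on dipaths inside one member of the cover\<close>

lemma ob_Obj:
  assumes "x \<in> X"
  shows "ob x \<in> Obj E"
proof -
  obtain U where U: "U \<in> \<U>" "x \<in> U" using in_cover[OF assms] by blast
  then have "(\<lambda>t. x) \<in> dip D U" using cover_subset by (intro dip_const)
  then show ?thesis using g_hom[OF U(1)] hom_obj[OF E] by blast
qed

lemma g_equiv:
  assumes "U \<in> \<U>" "equivclp (dhtp D U) \<gamma> \<delta>"
  shows "g \<gamma> = g \<delta>"
  using assms(2) by (induction rule: equivclp_induct) (use g_dhtp[OF assms(1)] in metis)+

lemma g_eq_on:
  assumes "U \<in> \<U>" "\<gamma> \<in> dip D U" "\<And>t. t \<in> {0..1} \<Longrightarrow> \<delta> t = \<gamma> t"
  shows "g \<delta> = g \<gamma>"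
  using g_dhtp[OF assms(1) dhtp_eq_on[OF assms(2,3)]] by simp

lemma g_segment_join:
  assumes "U \<in> \<U>" "\<gamma> \<in> D" "0 \<le> u" "u \<le> v" "v \<le> w" "w \<le> 1" "\<gamma> ` {u..w} \<subseteq> U"
  shows "g (\<gamma> \<circ> linepath u w) = Comp E (g (\<gamma> \<circ> linepath v w)) (g (\<gamma> \<circ> linepath u v))"
proof -
  have "g ((\<gamma> \<circ> linepath u v) +++ (\<gamma> \<circ> linepath v w)) = g (\<gamma> \<circ> linepath u w)"
    using assms by (intro g_equiv[OF assms(1)] equiv_linepath_join)
  moreover have "\<gamma> ` {u..v} \<subseteq> U" "\<gamma> ` {v..w} \<subseteq> U"
    using assms by (auto simp: image_subset_iff)
  then have "\<gamma> \<circ> linepath u v \<in> dip D U" "\<gamma> \<circ> linepath v w \<in> dip D U"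
    using assms by (auto intro: dip_segment)
  ultimately show ?thesis
    using g_join[OF assms(1), of "\<gamma> \<circ> linepath u v" "\<gamma> \<circ> linepath v w"]
    by (simp add: linepath_0' linepath_1')
qed

lemma g_segment_hom:
  assumes "U \<in> \<U>" "\<gamma> \<in> D" "0 \<le> u" "u \<le> v" "v \<le> 1" "\<gamma> ` {u..v} \<subseteq> U"
  shows "g (\<gamma> \<circ> linepath u v) \<in> hom E (ob (\<gamma> u)) (ob (\<gamma> v))"
  using g_hom[OF assms(1) dip_segment[OF assms(2-6)]] by (simp add: linepath_0' linepath_1')

text \<open>The product over the first m of n equal pieces; later pieces stand on the left because
  \<open>Comp E\<close> takes the later arrow first. Partial products are kept since the proofs
  proceed from cut point to cut point.\<close>

primrec word :: "nat \<Rightarrow> (real \<Rightarrow> 'a) \<Rightarrow> nat \<Rightarrow> 'm" where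
  "word n \<gamma> 0 = Id E (ob (\<gamma> 0))"
| "word n \<gamma> (Suc m) = Comp E (g (\<gamma> \<circ> linepath (real m / n) (real (Suc m) / n))) (word n \<gamma> m)"

declare word.simps(2) [simp del]

lemma D_in: "\<gamma> \<in> D \<Longrightarrow> t \<in> {0..1} \<Longrightarrow> \<gamma> t \<in> X"
  using D_image unfolding path_image_def by blast

lemma word_hom:
  assumes "subordinate n \<gamma>" "m \<le> n"
  shows "word n \<gamma> m \<in> hom E (ob (\<gamma> 0)) (ob (\<gamma> (real m / n)))"
  using assms(2)
proof (induction m)
  case 0
  have "\<gamma> 0 \<in> X" using assms D_in by (auto simp: subordinate_def)
  then show ?case using hom_Id[OF E] ob_Obj by simp
next
  case (Suc m)
  then have m: "m < n" by simp
  obtain U where U: "U \<in> \<U>" "\<gamma> ` {real m / n..real (Suc m) / n} \<subseteq> U"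
    using assms(1) m unfolding subordinate_def by blast
  have "g (\<gamma> \<circ> linepath (real m / n) (real (Suc m) / n)) \<in> hom E (ob (\<gamma> (real m / n))) (ob (\<gamma> (real (Suc m) / n)))"
    using U assms(1) frac_bounds[OF m] by (intro g_segment_hom) (auto simp: subordinate_def)
  then show ?case
    using hom_comp[OF E] Suc.IH m by (simp add: word.simps(2))
qed

lemma word_refine:
  assumes n: "subordinate n \<gamma>" and k: "0 < k" and m: "m \<le> n"
  shows "word (n * k) \<gamma> (m * k) = word n \<gamma> m"
  using m
proof (induction m)
  case (Suc m)
  then have m: "m < n" by simp
  have \<gamma>: "\<gamma> \<in> D" and n0: "0 < n" using n by (auto simp: subordinate_def)
  obtain U where U: "U \<in> \<U>" "\<gamma> ` {real m / n..real (Suc m) / n} \<subseteq> U"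
    using n m unfolding subordinate_def by blast
  note b = frac_bounds[OF m]
  \<comment> \<open>The fine cut points inside coarse piece m: \<open>p 0\<close> and
    \<open>p k\<close> are the ends of that piece.\<close>
  define p where "p l = real (m * k + l) / real (n * k)" for l
  have p0: "p 0 = real m / n" and pk: "p k = real (Suc m) / n"
    using k n0 by (simp_all add: p_def field_simps)
  have pmono: "p i \<le> p j" if "i \<le> j" for i j
    unfolding p_def using that by (intro divide_right_mono) auto
  have "word (n * k) \<gamma> (m * k + l) = Comp E (g (\<gamma> \<circ> linepath (p 0) (p l))) (word n \<gamma> m)" if "l \<le> k" for l
    using that
  proof (induction l)
    case 0
    have "\<gamma> \<circ> linepath (p 0) (p 0) = (\<lambda>t. \<gamma> (real m / n))"
      by (simp add: fun_eq_iff linepath_real p0)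
    moreover have "\<gamma> (real m / n) \<in> X" using b by (intro D_in[OF \<gamma>]) simp
    ultimately have "g (\<gamma> \<circ> linepath (p 0) (p 0)) = Id E (ob (\<gamma> (real m / n)))"
      using g_const by simp
    moreover have "word (n * k) \<gamma> (m * k + 0) = word n \<gamma> m"
      using Suc.IH m by simp
    moreover have "Comp E (Id E (ob (\<gamma> (real m / n)))) (word n \<gamma> m) = word n \<gamma> m"
      using hom_Id_left[OF E word_hom[OF n]] m by simp
    ultimately show ?case by (simp only:)
  next
    case (Suc l)
    have le: "0 \<le> p 0" "p 0 \<le> p l" "p l \<le> p (Suc l)" "p (Suc l) \<le> p k" "p k \<le> 1"
      using b Suc.prems pmono[of 0 l] pmono[of l "Suc l"] pmono[of "Suc l" k]
      by (simp_all add: p0 pk del: of_nat_Suc)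
    have im: "\<gamma> ` {u..v} \<subseteq> U" if "p 0 \<le> u" "v \<le> p k" for u v
      using U(2) that by (force simp: p0 pk)
    have h: "g (\<gamma> \<circ> linepath u v) \<in> hom E (ob (\<gamma> u)) (ob (\<gamma> v))" if "p 0 \<le> u" "u \<le> v" "v \<le> p k" for u v
      using that le by (intro g_segment_hom[OF U(1) \<gamma>] im) auto
    have "word (n * k) \<gamma> (m * k + Suc l)
        = Comp E (g (\<gamma> \<circ> linepath (p l) (p (Suc l)))) (Comp E (g (\<gamma> \<circ> linepath (p 0) (p l))) (word n \<gamma> m))"
    proof -
      have "word (n * k) \<gamma> (m * k + l) = Comp E (g (\<gamma> \<circ> linepath (p 0) (p l))) (word n \<gamma> m)"
        by (rule Suc.IH) (use Suc.prems in simp)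
      moreover have "real (Suc (m * k + l)) / real (n * k) = p (Suc l)"
        "real (m * k + l) / real (n * k) = p l"
        by (simp_all add: p_def)
      ultimately show ?thesis by (simp only: word.simps(2) add_Suc_right)
    qed
    also have "\<dots> = Comp E (Comp E (g (\<gamma> \<circ> linepath (p l) (p (Suc l)))) (g (\<gamma> \<circ> linepath (p 0) (p l)))) (word n \<gamma> m)"
      by (rule hom_assoc[OF E _ h h]) (use le m word_hom[OF n, of m] in \<open>simp_all add: p0\<close>)
    also have "\<dots> = Comp E (g (\<gamma> \<circ> linepath (p 0) (p (Suc l)))) (word n \<gamma> m)"
      using g_segment_join[OF U(1) \<gamma> le(1-3)] le im by simp
    finally show ?case .
  qed
  from this[of k] show ?case
    by (simp add: p0 pk word.simps(2) add.commute del: of_nat_Suc)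
qed simp

text \<open>Both words equal the one over the common refinement into n * n' pieces.\<close>

lemma word_unique:
  assumes "subordinate n \<gamma>" "subordinate n' \<gamma>"
  shows "word n \<gamma> n = word n' \<gamma> n'"
proof -
  have "0 < n" "0 < n'" using assms by (auto simp: subordinate_def)
  then show ?thesis
    using word_refine[OF assms(1), of n' n] word_refine[OF assms(2), of n n']
    by (simp add: mult.commute)
qed

text \<open>The 2n pieces of the concatenation coincide on \<open>{0..1}\<close> with the n pieces
  of \<gamma> followed by those of \<delta>. Their values thus agree factor by factor, and only
  associativity remains.\<close>

lemma word_join:
  assumes \<gamma>: "subordinate n \<gamma>" and \<delta>: "subordinate n \<delta>" and e: "\<gamma> 1 = \<delta> 0"
  shows "word (2 * n) (\<gamma> +++ \<delta>) (2 * n) = Comp E (word n \<delta> n) (word n \<gamma> n)"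
proof -
  have n: "0 < n" and D: "\<gamma> \<in> D" "\<delta> \<in> D" using \<gamma> \<delta> by (auto simp: subordinate_def)
  have half: "linepath (u / 2) (v / 2) s = linepath u v s / 2"
    "linepath (1 + u) (1 + v) s = 1 + linepath u v s" for u v s :: real
    by (simp_all add: linepath_real field_simps)
  have g1: "g ((\<gamma> +++ \<delta>) \<circ> linepath (real i / real (2 * n)) (real (Suc i) / real (2 * n)))
      = g (\<gamma> \<circ> linepath (real i / n) (real (Suc i) / n))" if i: "i < n" for i
  proof -
    obtain U where U: "U \<in> \<U>" "\<gamma> ` {real i / n..real (Suc i) / n} \<subseteq> U"
      using \<gamma> i unfolding subordinate_def by blast
    have *: "real i / real (2 * n) = (real i / n) / 2" "real (Suc i) / real (2 * n) = (real (Suc i) / n) / 2"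
      by simp_all
    show ?thesis
      unfolding * using frac_bounds[OF i] joinpaths_halves(1)[of _ \<gamma> \<delta>, OF linepath_frac_in[OF i] e]
      by (intro g_eq_on[OF U(1)] dip_segment[OF D(1) _ _ _ U(2)]) (simp_all only: half comp_apply)
  qed
  have g2: "g ((\<gamma> +++ \<delta>) \<circ> linepath (real (n + i) / real (2 * n)) (real (Suc (n + i)) / real (2 * n)))
      = g (\<delta> \<circ> linepath (real i / n) (real (Suc i) / n))" if i: "i < n" for i
  proof -
    obtain U where U: "U \<in> \<U>" "\<delta> ` {real i / n..real (Suc i) / n} \<subseteq> U"
      using \<delta> i unfolding subordinate_def by blast
    have *: "real (n + i) / real (2 * n) = (1 + real i / n) / 2"
      "real (Suc (n + i)) / real (2 * n) = (1 + real (Suc i) / n) / 2"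
      using n by (simp_all add: field_simps)
    show ?thesis
      unfolding * using frac_bounds[OF i] joinpaths_halves(2)[of _ \<gamma> \<delta>, OF linepath_frac_in[OF i] e]
      by (intro g_eq_on[OF U(1)] dip_segment[OF D(2) _ _ _ U(2)]) (simp_all only: half comp_apply)
  qed
  have w1: "word (2 * n) (\<gamma> +++ \<delta>) m = word n \<gamma> m" if "m \<le> n" for m
    using that
  proof (induction m)
    case 0
    then show ?case by (simp add: joinpaths_def)
  next
    case (Suc m)
    then show ?case using g1[of m] by (simp add: word.simps(2) del: of_nat_Suc)
  qed
  have "word (2 * n) (\<gamma> +++ \<delta>) (n + m) = Comp E (word n \<delta> m) (word n \<gamma> n)" if "m \<le> n" for m
    using that
  proof (induction m)
    case 0
    have "word n \<gamma> n \<in> hom E (ob (\<gamma> 0)) (ob (\<delta> 0))"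
      using word_hom[OF \<gamma>, of n] n e by simp
    then show ?case using w1[of n] hom_Id_left[OF E] by simp
  next
    case (Suc m)
    then have m: "m < n" by simp
    obtain U where U: "U \<in> \<U>" "\<delta> ` {real m / n..real (Suc m) / n} \<subseteq> U"
      using \<delta> m unfolding subordinate_def by blast
    have 1: "word n \<gamma> n \<in> hom E (ob (\<gamma> 0)) (ob (\<delta> 0))"
      using word_hom[OF \<gamma>, of n] n e by simp
    have 2: "word n \<delta> m \<in> hom E (ob (\<delta> 0)) (ob (\<delta> (real m / n)))"
      using word_hom[OF \<delta>, of m] m by simp
    have 3: "g (\<delta> \<circ> linepath (real m / n) (real (Suc m) / n)) \<in> hom E (ob (\<delta> (real m / n))) (ob (\<delta> (real (Suc m) / n)))"
      using U D(2) frac_bounds[OF m] by (intro g_segment_hom) auto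
    show ?case
      using Suc m g2[OF m] hom_assoc[OF E 1 2 3] by (simp add: word.simps(2) del: of_nat_Suc)
  qed
  from this[of n] show ?thesis by (simp add: mult_2)
qed

text \<open>Needed because the extreme rows of a homotopy agree with the given dipaths on
  \<open>{0..1}\<close> only, whereas \<open>word\<close> is applied to functions on all
  reals.\<close>

lemma word_eq_on:
  assumes \<alpha>: "subordinate n \<alpha>" and eq: "\<And>t. t \<in> {0..1} \<Longrightarrow> \<alpha> t = \<beta> t"
  shows "subordinate n \<beta> \<and> word n \<beta> n = word n \<alpha> n"
proof
  have n: "0 < n" using \<alpha> by (simp add: subordinate_def)
  show sub: "subordinate n \<beta>"
    unfolding subordinate_def
  proof (intro conjI allI impI n)
    show "\<beta> \<in> D" using \<alpha> D_cong[of \<alpha> \<beta>] eq by (simp add: subordinate_def)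
    fix i assume i: "i < n"
    then obtain U where "U \<in> \<U>" "\<alpha> ` {real i / n..real (Suc i) / n} \<subseteq> U"
      using \<alpha> unfolding subordinate_def by blast
    moreover have "\<beta> ` {real i / n..real (Suc i) / n} = \<alpha> ` {real i / n..real (Suc i) / n}"
      using frac_interval[OF i] eq by (intro image_cong) (simp_all add: subset_iff)
    ultimately show "\<exists>U\<in>\<U>. \<beta> ` {real i / n..real (Suc i) / n} \<subseteq> U" by auto
  qed
  have "word n \<beta> m = word n \<alpha> m" if "m \<le> n" for m
    using that
  proof (induction m)
    case 0
    then show ?case using eq[of 0] by simp
  next
    case (Suc m)
    then have m: "m < n" by simp
    then obtain U where U: "U \<in> \<U>" "\<alpha> ` {real m / n..real (Suc m) / n} \<subseteq> U"
      using \<alpha> unfolding subordinate_def by blast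
    have "g (\<beta> \<circ> linepath (real m / n) (real (Suc m) / n)) = g (\<alpha> \<circ> linepath (real m / n) (real (Suc m) / n))"
    proof (rule g_eq_on[OF U(1)])
      show "\<alpha> \<circ> linepath (real m / n) (real (Suc m) / n) \<in> dip D U"
        using frac_bounds[OF m] U(2) \<alpha> by (intro dip_segment) (auto simp: subordinate_def)
      fix t :: real assume t: "t \<in> {0..1}"
      show "(\<beta> \<circ> linepath (real m / n) (real (Suc m) / n)) t = (\<alpha> \<circ> linepath (real m / n) (real (Suc m) / n)) t"
        using eq[OF linepath_frac_in[OF m t]] by simp
    qed
    then show ?case using Suc m by (simp add: word.simps(2))
  qed
  then show "word n \<beta> n = word n \<alpha> n" by simp
qed

text \<open>The two boundary paths of a cell are dipaths of the square with common ends, so their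
  images are dihomotopic inside \<open>U\<close> itself, where \<open>g\<close> is known to be
  invariant.\<close>

lemma g_square:
  assumes U: "U \<in> \<U>" and H: "dimap2 D X H"
    and ab: "0 \<le> a" "a \<le> a'" "a' \<le> 1" "0 \<le> b" "b \<le> b'" "b' \<le> 1"
    and HU: "H ` ({a..a'} \<times> {b..b'}) \<subseteq> U"
  shows "Comp E (g (H \<circ> linepath (a',b) (a',b'))) (g (H \<circ> linepath (a,b) (a',b)))
       = Comp E (g (H \<circ> linepath (a,b') (a',b'))) (g (H \<circ> linepath (a,b) (a,b')))"
proof -
  have edge: "H \<circ> linepath (c,d) (c',d') \<in> dip D U"
    if c: "a \<le> c" "c \<le> c'" "c' \<le> a'" "b \<le> d" "d \<le> d'" "d' \<le> b'" for c c' d d'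
  proof -
    have "H \<circ> linepath (c,d) (c',d') \<in> D"
      using H square_dipath_linepath[of c c' d d'] that ab unfolding dimap2_alt dip_def by auto
    moreover have "linepath (c,d) (c',d') t \<in> {a..a'} \<times> {b..b'}" if t: "t \<in> {0..1}" for t
    proof -
      have "linepath (c,d) (c',d') t = (linepath c c' t, linepath d d' t)"
        by (simp add: linepath_def)
      then show ?thesis
        using linepath_real_in[OF c(2) t] linepath_real_in[OF c(5) t] c by auto
    qed
    then have "path_image (H \<circ> linepath (c,d) (c',d')) \<subseteq> U"
      using HU unfolding path_image_def comp_def by blast
    ultimately show ?thesis by (simp add: dip_def)
  qed
  let ?p = "linepath (a,b) (a',b) +++ linepath (a',b) (a',b')"
  let ?q = "linepath (a,b) (a,b') +++ linepath (a,b') (a',b')"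
  have "equivclp (dhtp D U) (H \<circ> ?p) (H \<circ> ?q)"
  proof (rule equiv_square[OF H])
    show "square_dipath ?p" "square_dipath ?q"
      using ab by (auto intro!: square_dipath_join square_dipath_linepath simp: linepath_0' linepath_1')
  qed (use HU in \<open>auto simp: joinpaths_def linepath_0' linepath_1'\<close>)
  then have "g (H \<circ> ?p) = g (H \<circ> ?q)" by (rule g_equiv[OF U])
  then show ?thesis
    using ab by (simp add: path_compose_join g_join[OF U] edge linepath_0' linepath_1')
qed

text \<open>Neighbouring rows of the grid are compared along a ladder whose rungs are the vertical
  edges: each cell moves the rung one place to the right. The homotopy fixes the ends, so the first
  and the last rung are identities.\<close>

lemma word_dhtp:
  assumes "dhtp D X \<gamma> \<delta>"
  shows "\<exists>n. subordinate n \<gamma> \<and> subordinate n \<delta> \<and> word n \<gamma> n = word n \<delta> n"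
proof -
  obtain H where H: "dimap2 D X H" "\<And>t. t\<in>{0..1} \<Longrightarrow> H (t, 0) = \<gamma> t" "\<And>t. t\<in>{0..1} \<Longrightarrow> H (t, 1) = \<delta> t"
      "\<And>s. s\<in>{0..1} \<Longrightarrow> H (0, s) = \<gamma> 0" "\<And>s. s\<in>{0..1} \<Longrightarrow> H (1, s) = \<gamma> 1"
    using assms unfolding dhtp_def by blast
  have \<gamma>\<delta>: "\<gamma> \<in> D" "\<delta> \<in> D" using dhtp_dip[OF assms] by (auto simp: dip_space)
  obtain n :: nat where n: "0 < n" and grid: "\<And>i j. i < n \<Longrightarrow> j < n \<Longrightarrow>
    \<exists>U\<in>\<U>. H ` ({real i / n..real (Suc i) / n} \<times> {real j / n..real (Suc j) / n}) \<subseteq> U"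
    using grid_subordinate[of H] H(1) unfolding dimap2_def by metis
  define row where "row j = (\<lambda>t. H (t, real j / n))" for j :: nat
  have row_seg: "row j \<circ> linepath u v = H \<circ> linepath (u, real j / n) (v, real j / n)" for j u v
    by (simp add: row_def fun_eq_iff linepath_def algebra_simps add_divide_distrib[symmetric])
  have row_D: "row j \<in> D" if j: "j \<le> n" for j
  proof -
    have "row j \<circ> linepath 0 1 \<in> D"
      unfolding row_seg using H(1) square_dipath_linepath[of 0 1 "real j / n" "real j / n"] j n
      unfolding dimap2_alt dip_def by auto
    moreover have "row j \<circ> linepath 0 1 = row j" by (simp add: fun_eq_iff linepath_real)
    ultimately show ?thesis by simp
  qed
  have row_sub: "subordinate n (row j)" if j: "j \<le> n" for j
    unfolding subordinate_def
  proof (intro conjI allI impI row_D j n)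
    fix i assume i: "i < n"
    \<comment> \<open>Row j bounds the layer of cells above it, except for the top row j = n, which
      belongs to the last layer n - 1.\<close>
    define k where "k = (if j < n then j else n - 1)"
    have k: "k < n" "real j / n \<in> {real k / n..real (Suc k) / n}"
      using j n by (auto simp: k_def divide_simps)
    obtain U where "U \<in> \<U>" "H ` ({real i / n..real (Suc i) / n} \<times> {real k / n..real (Suc k) / n}) \<subseteq> U"
      using grid[OF i k(1)] by blast
    then show "\<exists>U\<in>\<U>. row j ` {real i / n..real (Suc i) / n} \<subseteq> U"
      using k(2) unfolding row_def by (intro bexI[of _ U]) blast+
  qed
  define vert where "vert m j = g (H \<circ> linepath (real m / n, real j / n) (real m / n, real (Suc j) / n))" for m j :: nat
  have vert_end: "vert m j = Id E (ob (\<gamma> (real m / n)))" if "j < n" "m = 0 \<or> m = n" for m j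
  proof -
    have x: "\<gamma> (real m / n) \<in> X" using D_in[OF \<gamma>\<delta>(1)] that n by auto
    then obtain U where U: "U \<in> \<U>" "\<gamma> (real m / n) \<in> U" using in_cover by blast
    have "vert m j = g (\<lambda>t. \<gamma> (real m / n))"
      unfolding vert_def
    proof (rule g_eq_on[OF U(1)])
      show "(\<lambda>t. \<gamma> (real m / n)) \<in> dip D U" using U cover_subset by (intro dip_const)
      fix t :: real assume t: "t \<in> {0..1}"
      have "linepath (real j / n) (real (Suc j) / n) t \<in> {0..1}"
        by (rule linepath_frac_in[OF that(1) t])
      moreover have "linepath (real m / n, real j / n) (real m / n, real (Suc j) / n) t
          = (real m / n, linepath (real j / n) (real (Suc j) / n) t)"
        by (simp add: linepath_def algebra_simps add_divide_distrib[symmetric] del: of_nat_Suc)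
      ultimately show "(H \<circ> linepath (real m / n, real j / n) (real m / n, real (Suc j) / n)) t = \<gamma> (real m / n)"
        using that(2) H(4,5) n by auto
    qed
    then show ?thesis using g_const[OF x] by simp
  qed
  have row_ends: "row j 0 = \<gamma> 0" "row j 1 = \<gamma> 1" if "j \<le> n" for j
    using that n H(4,5) by (auto simp: row_def)
  have vert_hom: "vert m j \<in> hom E (ob (row j (real m / n))) (ob (row (Suc j) (real m / n)))"
    if mj: "m \<le> n" "j < n" for m j
  proof -
    \<comment> \<open>The same choice for columns: the right edge m = n belongs to the last column
      of cells.\<close>
    define k where "k = (if m < n then m else n - 1)"
    have k: "k < n" "real m / n \<in> {real k / n..real (Suc k) / n}"
      using mj n by (auto simp: k_def divide_simps)
    obtain U where U: "U \<in> \<U>" "H ` ({real k / n..real (Suc k) / n} \<times> {real j / n..real (Suc j) / n}) \<subseteq> U"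
      using grid[OF k(1) mj(2)] by blast
    let ?l = "linepath (real m / n, real j / n) (real m / n, real (Suc j) / n)"
    have "H \<circ> ?l \<in> D"
      using H(1) square_dipath_linepath[of "real m / n" "real m / n" "real j / n" "real (Suc j) / n"]
        frac_bounds[OF mj(2)] mj n
      unfolding dimap2_alt dip_def by auto
    moreover have "?l t \<in> {real k / n..real (Suc k) / n} \<times> {real j / n..real (Suc j) / n}"
      if t: "t \<in> {0..1}" for t
    proof -
      have "?l t = (real m / n, linepath (real j / n) (real (Suc j) / n) t)"
        by (simp add: linepath_def algebra_simps add_divide_distrib[symmetric] del: of_nat_Suc)
      then show ?thesis
        using k linepath_real_in[OF _ t, of "real j / n" "real (Suc j) / n"] frac_bounds[OF mj(2)]
        by (auto simp del: of_nat_Suc)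
    qed
    then have "path_image (H \<circ> ?l) \<subseteq> U" using U(2) unfolding path_image_def comp_def by blast
    ultimately have "H \<circ> ?l \<in> dip D U" by (simp add: dip_def)
    from g_hom[OF U(1) this] show ?thesis
      by (simp add: vert_def row_def linepath_0' linepath_1')
  qed
  have step: "word n (row j) n = word n (row (Suc j)) n" if j: "j < n" for j
  proof -
    have j': "j \<le> n" "Suc j \<le> n" using j by auto
    \<comment> \<open>The ladder invariant. The initial rung that would precede the upper word is an
      identity and has been dropped.\<close>
    have "Comp E (vert m j) (word n (row j) m) = word n (row (Suc j)) m" if "m \<le> n" for m
      using that
    proof (induction m)
      case 0
      have "\<gamma> 0 \<in> X" using D_in[OF \<gamma>\<delta>(1)] by simp
      then have "Id E (ob (\<gamma> 0)) \<in> hom E (ob (\<gamma> 0)) (ob (\<gamma> 0))" using hom_Id[OF E] ob_Obj by simp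
      then show ?case using vert_end[OF j, of 0] row_ends[OF j'(1)] row_ends[OF j'(2)] hom_Id_left[OF E] by simp
    next
      case (Suc m)
      then have m: "m < n" by simp
      obtain U where U: "U \<in> \<U>" "H ` ({real m / n..real (Suc m) / n} \<times> {real j / n..real (Suc j) / n}) \<subseteq> U"
        using grid[OF m j] by blast
      define lo hi where "lo = g (row j \<circ> linepath (real m / n) (real (Suc m) / n))"
        and "hi = g (row (Suc j) \<circ> linepath (real m / n) (real (Suc m) / n))"
      have lo: "lo \<in> hom E (ob (row j (real m / n))) (ob (row j (real (Suc m) / n)))"
      proof -
        have "row j ` {real m / n..real (Suc m) / n} \<subseteq> U"
          using U(2) frac_bounds[OF j] unfolding row_def by (auto simp: image_subset_iff)
        then show ?thesis
          unfolding lo_def using U(1) row_D[OF j'(1)] frac_bounds[OF m] by (intro g_segment_hom) auto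
      qed
      have hi: "hi \<in> hom E (ob (row (Suc j) (real m / n))) (ob (row (Suc j) (real (Suc m) / n)))"
      proof -
        have "row (Suc j) ` {real m / n..real (Suc m) / n} \<subseteq> U"
          using U(2) frac_bounds[OF j] unfolding row_def by (auto simp: image_subset_iff simp del: of_nat_Suc)
        then show ?thesis
          unfolding hi_def using U(1) row_D[OF j'(2)] frac_bounds[OF m] by (intro g_segment_hom) auto
      qed
      have w: "word n (row j) m \<in> hom E (ob (row j 0)) (ob (row j (real m / n)))"
        using word_hom[OF row_sub[OF j'(1)], of m] m by simp
      have sq: "Comp E (vert (Suc m) j) lo = Comp E hi (vert m j)"
        unfolding vert_def lo_def hi_def row_seg
        using frac_bounds[OF m] frac_bounds[OF j] by (intro g_square[OF U(1) H(1) _ _ _ _ _ _ U(2)]) auto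
      have "Comp E (vert (Suc m) j) (word n (row j) (Suc m))
          = Comp E (vert (Suc m) j) (Comp E lo (word n (row j) m))"
        by (simp add: word.simps(2) lo_def)
      also have "\<dots> = Comp E (Comp E (vert (Suc m) j) lo) (word n (row j) m)"
        using Suc.prems j by (intro hom_assoc[OF E w lo vert_hom])
      also have "\<dots> = Comp E hi (Comp E (vert m j) (word n (row j) m))"
        unfolding sq using m j by (intro hom_assoc[OF E w vert_hom hi, symmetric]) auto
      also have "\<dots> = word n (row (Suc j)) (Suc m)"
        using Suc.IH m by (simp add: word.simps(2) hi_def)
      finally show ?case .
    qed
    from this[of n] have "Comp E (vert n j) (word n (row j) n) = word n (row (Suc j)) n" by simp
    moreover have "word n (row j) n \<in> hom E (ob (\<gamma> 0)) (ob (\<gamma> 1))"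
      using word_hom[OF row_sub[OF j'(1)], of n] row_ends[OF j'(1)] n by simp
    then have "Comp E (vert n j) (word n (row j) n) = word n (row j) n"
      using vert_end[OF j, of n] n hom_Id_left[OF E] by simp
    ultimately show ?thesis by simp
  qed
  have rows: "word n (row 0) n = word n (row j) n" if "j \<le> n" for j
    using that by (induction j) (use step in auto)
  have "row 0 t = \<gamma> t" "row n t = \<delta> t" if "t \<in> {0..1}" for t
    using that H(2,3) n by (auto simp: row_def)
  then show ?thesis
    using word_eq_on[OF row_sub[of 0], of \<gamma>] word_eq_on[OF row_sub[of n], of \<delta>] rows[of n] by auto
qed

section \<open>The glued functor\<close>

definition glue :: "(real \<Rightarrow> 'a) \<Rightarrow> 'm" where
  "glue \<gamma> = (let n = SOME n. subordinate n \<gamma> in word n \<gamma> n)"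

lemma glue_eq: "subordinate n \<gamma> \<Longrightarrow> glue \<gamma> = word n \<gamma> n"
  unfolding glue_def Let_def by (rule word_unique[OF someI])

text \<open>The number of pieces may vary from link to link of the zigzag: within a link one grid
  serves both dipaths, and \<open>glue\<close> does not depend on the number.\<close>

lemma glue_equiv:
  assumes "equivclp (dhtp D X) \<gamma> \<delta>"
  shows "glue \<gamma> = glue \<delta>"
  using assms
proof (induction rule: equivclp_induct)
  case (step y z)
  have "glue y = glue z" using step(2) word_dhtp glue_eq by metis
  then show ?case using step.IH by simp
qed simp

lemma glue_hom:
  assumes "\<gamma> \<in> D"
  shows "glue \<gamma> \<in> hom E (ob (\<gamma> 0)) (ob (\<gamma> 1))"
proof -
  obtain n where n: "subordinate n \<gamma>" using subordinate_exists[OF assms] by blast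
  then show ?thesis using word_hom[OF n, of n] glue_eq[OF n] by (simp add: subordinate_def)
qed

text \<open>Subdivisions of the two factors into k and l pieces are both refined to k * l pieces,
  after which the words can be concatenated.\<close>

lemma glue_join:
  assumes "\<gamma> \<in> D" "\<delta> \<in> D" "\<gamma> 1 = \<delta> 0"
  shows "glue (\<gamma> +++ \<delta>) = Comp E (glue \<delta>) (glue \<gamma>)"
proof -
  obtain k l where k: "subordinate k \<gamma>" and l: "subordinate l \<delta>"
    using subordinate_exists assms by meson
  then have "0 < k" "0 < l" by (auto simp: subordinate_def)
  then have n: "subordinate (k * l) \<gamma>" "subordinate (k * l) \<delta>"
    using subordinate_mult[OF k, of l] subordinate_mult[OF l, of k] by (auto simp: mult.commute)
  show ?thesis
    using word_join[OF n assms(3)] glue_eq[OF n(1)] glue_eq[OF n(2)]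
      glue_eq[OF subordinate_join[OF n assms(3)]] by simp
qed

lemma glue_small:
  assumes "U \<in> \<U>" "\<gamma> \<in> dip D U"
  shows "glue \<gamma> = g \<gamma>"
proof -
  have "subordinate 1 \<gamma>"
    using assms by (auto simp: subordinate_def dip_def path_image_def)
  moreover have "\<gamma> \<circ> linepath 0 1 = \<gamma>" by (simp add: fun_eq_iff linepath_real)
  ultimately show ?thesis
    using hom_Id_right[OF E g_hom[OF assms]] by (simp add: glue_eq word.simps(2))
qed

text \<open>The restriction to objects in \<open>A\<close> comes only at this stage: the words
  behind \<open>glue\<close> pass through cut points anywhere in \<open>X\<close>, where
  \<open>ob\<close> is available.\<close>

lemma functor_extension:
  assumes "A \<subseteq> X"
  shows "\<exists>F. is_functor (fcat D X A) E F \<and> (\<forall>x. fst F x = ob x) \<and>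
    (\<forall>U\<in>\<U>. \<forall>\<gamma>\<in>dip D U. snd F (mor X \<gamma>) = g \<gamma>)"
proof -
  define F where "F = (ob, \<lambda>f. glue (rep f))"
  have F: "snd F (mor X \<gamma>) = glue \<gamma>" for \<gamma>
    unfolding F_def using glue_equiv[OF rep_mor[of X \<gamma>]] by simp
  have Id: "glue (\<lambda>t. x) = Id E (ob x)" if x: "x \<in> A" for x
  proof -
    obtain U where U: "U \<in> \<U>" "x \<in> U" using in_cover x assms by blast
    then have "(\<lambda>t. x) \<in> dip D U" using cover_subset by (intro dip_const)
    then show ?thesis using glue_small[OF U(1)] g_const x assms by auto
  qed
  have "is_functor (fcat D X A) E F"
    unfolding is_functor_def
  proof (intro conjI ballI impI)
    fix x assume "x \<in> Obj (fcat D X A)"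
    then show "fst F x \<in> Obj E" "snd F (Id (fcat D X A) x) = Id E (fst F x)"
      using assms ob_Obj Id by (auto simp: Id_fcat F) (auto simp: F_def)
  next
    fix f assume "f \<in> Arr (fcat D X A)"
    then show "snd F f \<in> hom E (fst F (Dom (fcat D X A) f)) (fst F (Cod (fcat D X A) f))"
      using glue_hom by (auto simp: Arr_fcat F dip_space) (auto simp: F_def)
  next
    fix f h assume "f \<in> Arr (fcat D X A)" "h \<in> Arr (fcat D X A)" "Dom (fcat D X A) h = Cod (fcat D X A) f"
    then show "snd F (Comp (fcat D X A) h f) = Comp E (snd F h) (snd F f)"
      by (auto simp: Arr_fcat Comp_fcat F dip_space glue_join)
  qed
  moreover have "snd F (mor X \<gamma>) = g \<gamma>" if "U \<in> \<U>" "\<gamma> \<in> dip D U" for U \<gamma>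
    using F glue_small that by simp
  ultimately show ?thesis by (intro exI[of _ F]) (auto simp: F_def)
qed

end

section \<open>Future retracts and the pushout\<close>

lemma is_functor_fcomp:
  "is_functor C B F \<Longrightarrow> is_functor B E G \<Longrightarrow> is_functor C E (fcomp G F)"
  unfolding is_functor_def fcomp_def hom_def by auto

lemma future_retractD:
  assumes "future_retract C Cs P \<eta>"
  shows "is_functor C Cs P"
    and "x \<in> Obj C \<Longrightarrow> \<eta> x \<in> hom C x (fst P x)"
    and "f \<in> Arr C \<Longrightarrow> Comp C (snd P f) (\<eta> (Dom C f)) = Comp C (\<eta> (Cod C f)) f"
    and "a \<in> Obj Cs \<Longrightarrow> \<eta> a = Id C a"
  using assms unfolding future_retract_def by simp_all

section \<open>Functors on fundamental categories, inclusions and retracts\<close>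

context directed_space
begin

text \<open>Rewrites a functor on classes as laws for a function of dipaths, the form in which
  \<open>local_functor\<close> asks for them.\<close>

lemma functor_mor:
  assumes G: "is_functor (fcat D Y A) E G" and "A \<subseteq> Y" "Y \<subseteq> X"
  shows "\<gamma> \<in> dip D Y \<Longrightarrow> \<gamma> 0 \<in> A \<Longrightarrow> \<gamma> 1 \<in> A \<Longrightarrow>
      snd G (mor Y \<gamma>) \<in> hom E (fst G (\<gamma> 0)) (fst G (\<gamma> 1))"
    and "\<gamma> \<in> dip D Y \<Longrightarrow> \<gamma> 0 \<in> A \<Longrightarrow> \<gamma> 1 \<in> A \<Longrightarrow> \<delta> \<in> dip D Y \<Longrightarrow> \<delta> 1 \<in> A \<Longrightarrow> \<gamma> 1 = \<delta> 0 \<Longrightarrow>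
      snd G (mor Y (\<gamma> +++ \<delta>)) = Comp E (snd G (mor Y \<delta>)) (snd G (mor Y \<gamma>))"
    and "x \<in> A \<Longrightarrow> snd G (mor Y (\<lambda>t. x)) = Id E (fst G x)"
proof -
  have arr: "mor Y \<gamma> \<in> Arr (fcat D Y A)" if "\<gamma> \<in> dip D Y" "\<gamma> 0 \<in> A" "\<gamma> 1 \<in> A" for \<gamma>
    using that unfolding Arr_fcat by blast
  show "snd G (mor Y \<gamma>) \<in> hom E (fst G (\<gamma> 0)) (fst G (\<gamma> 1))"
    if "\<gamma> \<in> dip D Y" "\<gamma> 0 \<in> A" "\<gamma> 1 \<in> A"
    using G arr[OF that] unfolding is_functor_def by fastforce
  show "snd G (mor Y (\<gamma> +++ \<delta>)) = Comp E (snd G (mor Y \<delta>)) (snd G (mor Y \<gamma>))"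
    if "\<gamma> \<in> dip D Y" "\<gamma> 0 \<in> A" "\<gamma> 1 \<in> A" "\<delta> \<in> dip D Y" "\<delta> 1 \<in> A" "\<gamma> 1 = \<delta> 0"
  proof -
    have "mor Y \<gamma> \<in> Arr (fcat D Y A)" "mor Y \<delta> \<in> Arr (fcat D Y A)"
      using that by (auto intro!: arr)
    then have "snd G (Comp (fcat D Y A) (mor Y \<delta>) (mor Y \<gamma>)) = Comp E (snd G (mor Y \<delta>)) (snd G (mor Y \<gamma>))"
      using G that(6) unfolding is_functor_def by simp
    then show ?thesis using that by (simp add: Comp_fcat)
  qed
  show "snd G (mor Y (\<lambda>t. x)) = Id E (fst G x)" if "x \<in> A"
    using G that unfolding is_functor_def by (simp add: Id_fcat)
qed

lemma functor_incl:
  assumes "Y \<subseteq> Z" "Z \<subseteq> X" "A \<subseteq> Y" "A \<subseteq> B"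
  shows "is_functor (fcat D Y A) (fcat D Z B) (incl D Z)"
proof -
  have YZ: "\<gamma> \<in> dip D Z" if "\<gamma> \<in> dip D Y" for \<gamma> using that assms(1) by (auto simp: dip_def)
  show ?thesis
    unfolding is_functor_def
  proof (intro conjI ballI impI)
    fix x assume "x \<in> Obj (fcat D Y A)"
    then show "fst (incl D Z) x \<in> Obj (fcat D Z B)"
      "snd (incl D Z) (Id (fcat D Y A) x) = Id (fcat D Z B) (fst (incl D Z) x)"
      using assms dip_const[of x Y] incl_mor[of "\<lambda>t. x" Y Z] by (auto simp: Id_fcat)
  next
    fix f assume "f \<in> Arr (fcat D Y A)"
    then obtain \<gamma> where f: "\<gamma> \<in> dip D Y" "\<gamma> 0 \<in> A" "\<gamma> 1 \<in> A" "f = mor Y \<gamma>" unfolding Arr_fcat by blast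
    then have "mor Z \<gamma> \<in> Arr (fcat D Z B)" using YZ assms(4) unfolding Arr_fcat by blast
    then show "snd (incl D Z) f \<in> hom (fcat D Z B) (fst (incl D Z) (Dom (fcat D Y A) f))
        (fst (incl D Z) (Cod (fcat D Y A) f))"
      using f assms(1) by (simp add: hom_def incl_mor)
  next
    fix f h assume "f \<in> Arr (fcat D Y A)" "h \<in> Arr (fcat D Y A)" "Dom (fcat D Y A) h = Cod (fcat D Y A) f"
    then show "snd (incl D Z) (Comp (fcat D Y A) h f) = Comp (fcat D Z B) (snd (incl D Z) h) (snd (incl D Z) f)"
      using assms(1) YZ by (auto simp: Arr_fcat Comp_fcat incl_mor dip_join)
  qed
qed

lemma incl_incl:
  assumes "f \<in> Arr (fcat D Y A)" "Y \<subseteq> Z" "Z \<subseteq> W"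
  shows "snd (incl D W) (snd (incl D Z) f) = snd (incl D W) f"
proof -
  obtain \<gamma> where \<gamma>: "\<gamma> \<in> dip D Y" "f = mor Y \<gamma>" using assms(1) unfolding Arr_fcat by blast
  then have "\<gamma> \<in> dip D Z" using assms(2) by (auto simp: dip_def)
  then show ?thesis using \<gamma> assms incl_mor[of \<gamma> Y W] by (simp add: incl_mor)
qed

lemma Arr_fcat_mono: "A \<subseteq> B \<Longrightarrow> Arr (fcat D Y A) \<subseteq> Arr (fcat D Y B)"
  unfolding subset_iff Arr_fcat by blast

text \<open>At a point of \<open>A\<close> the unit is an identity whose codomain is the retracted
  point, so that point is fixed. For an arrow between such points the naturality square has
  identities as units and reduces to \<open>snd P f = f\<close>.\<close>

lemma future_retract_id:
  assumes R: "future_retract (fcat D Y Y) (fcat D Y A) P \<eta>" and AY: "A \<subseteq> Y" "Y \<subseteq> X"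
  shows "a \<in> A \<Longrightarrow> fst P a = a"
    and "f \<in> Arr (fcat D Y A) \<Longrightarrow> snd P f = f"
proof -
  let ?C = "fcat D Y Y"
  have C: "category ?C" using AY by (intro category_fcat) auto
  have \<eta>: "\<eta> a = Id ?C a" "\<eta> a \<in> hom ?C a (fst P a)" if "a \<in> A" for a
    using future_retractD(2,4)[OF R, of a] that AY by auto
  show obj: "fst P a = a" if "a \<in> A" for a
    using \<eta>[OF that] by (simp add: hom_def Id_fcat)
  show "snd P f = f" if f: "f \<in> Arr (fcat D Y A)"
  proof -
    have fC: "f \<in> Arr ?C" using f Arr_fcat_mono AY by blast
    have ends: "fst f \<in> A" "fst (snd f) \<in> A" using f by (auto simp: Arr_fcat)
    have "snd P f \<in> hom (fcat D Y A) (fst P (fst f)) (fst P (fst (snd f)))"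
      using R fC unfolding future_retract_def is_functor_def by simp
    then have Pf: "snd P f \<in> hom ?C (fst f) (fst (snd f))"
      using obj ends Arr_fcat_mono[OF AY(1)] unfolding hom_def by auto
    have "f \<in> hom ?C (fst f) (fst (snd f))" using fC by (simp add: hom_def)
    moreover have "Comp ?C (snd P f) (\<eta> (fst f)) = Comp ?C (\<eta> (fst (snd f))) f"
      using R fC unfolding future_retract_def by simp
    ultimately show ?thesis
      using hom_Id_left[OF C] hom_Id_right[OF C Pf] \<eta>(1) ends by simp
  qed
qed

end

text \<open>The unit pushes a subdivided dipath between points of \<open>A\<close> into the subcategories
  generated by the retracts: \<open>\<eta>\<close> is the identity at both ends, and naturality moves it past
  every piece.\<close>

lemma (in covered_space) arrows_generated:
  fixes p :: "'a \<Rightarrow> 'a" and h :: "'a \<Rightarrow> 'a dmor"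
  assumes AX: "A \<subseteq> X"
    and local: "\<And>U. U \<in> \<U> \<Longrightarrow> \<exists>B P \<eta>. B \<subseteq> U \<and> B \<subseteq> A \<and>
      future_retract (fcat D U U) (fcat D U B) P \<eta> \<and>
      (\<forall>x\<in>U. p x = fst P x \<and> h x = snd (incl D X) (\<eta> x)) \<and>
      (\<forall>f\<in>Arr (fcat D U B). snd (incl D X) f \<in> S)"
    and comp: "\<And>f f'. f \<in> S \<Longrightarrow> f' \<in> S \<Longrightarrow> f \<in> Arr (fcat D X A) \<Longrightarrow> f' \<in> Arr (fcat D X A) \<Longrightarrow>
      Dom (fcat D X A) f' = Cod (fcat D X A) f \<Longrightarrow> Comp (fcat D X A) f' f \<in> S"
    and retract: "\<And>a. a \<in> A \<Longrightarrow> p a = a \<and> h a = Id (fcat D X A) a"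
  shows "Arr (fcat D X A) \<subseteq> S"
proof
  fix f assume "f \<in> Arr (fcat D X A)"
  then obtain \<gamma> where f: "\<gamma> \<in> D" "\<gamma> 0 \<in> A" "\<gamma> 1 \<in> A" "f = mor X \<gamma>"
    unfolding Arr_fcat dip_space by blast
  let ?C = "fcat D X X"
  have C: "category ?C" by (intro category_fcat) auto
  have mor_C: "mor X \<gamma> \<in> hom ?C (\<gamma> 0) (\<gamma> 1)" if "\<gamma> \<in> D" for \<gamma>
  proof -
    have "\<gamma> 0 \<in> X" "\<gamma> 1 \<in> X" using D_image[OF that] by (auto simp: path_image_def image_subset_iff)
    then have "mor X \<gamma> \<in> Arr ?C" using that unfolding Arr_fcat dip_space by blast
    then show ?thesis by (simp add: hom_def)
  qed
  have hC: "h x \<in> hom ?C x (p x)" if x: "x \<in> X" for x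
  proof -
    obtain U where U: "U \<in> \<U>" "x \<in> U" using in_cover[OF x] by blast
    note UX = cover_subset[OF U(1)]
    obtain B P \<eta> where P: "B \<subseteq> U" "future_retract (fcat D U U) (fcat D U B) P \<eta>"
      "p x = fst P x" "h x = snd (incl D X) (\<eta> x)"
      using local[OF U(1)] U(2) by blast
    have "\<eta> x \<in> hom (fcat D U U) x (fst P x)"
      using P(2) U(2) unfolding future_retract_def by simp
    then show ?thesis
      using functor_incl[of U X U X] UX P(3,4) unfolding is_functor_def hom_def by auto
  qed
  \<comment> \<open>The arrow k plays the part of the retracted \<gamma>, with its naturality
    square. Asking only for its existence avoids constructing a retraction functor on the whole
    fundamental category of \<open>X\<close>.\<close>
  define Q where "Q \<gamma> \<longleftrightarrow> (\<exists>k\<in>S. k \<in> hom (fcat D X A) (p (\<gamma> 0)) (p (\<gamma> 1)) \<and>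
      Comp ?C k (h (\<gamma> 0)) = Comp ?C (h (\<gamma> 1)) (mor X \<gamma>))" for \<gamma>
  have "Q \<gamma>"
    using f(1)
  proof (rule dipath_cover_induct)
    fix U \<gamma> assume U: "U \<in> \<U>" and \<gamma>: "\<gamma> \<in> dip D U"
    note UX = cover_subset[OF U]
    obtain B P \<eta> where B: "B \<subseteq> U" "B \<subseteq> A" and P: "future_retract (fcat D U U) (fcat D U B) P \<eta>"
      and ph: "\<And>x. x \<in> U \<Longrightarrow> p x = fst P x \<and> h x = snd (incl D X) (\<eta> x)"
      and S: "\<And>f. f \<in> Arr (fcat D U B) \<Longrightarrow> snd (incl D X) f \<in> S"
      using local[OF U] by blast
    have ends: "\<gamma> 0 \<in> U" "\<gamma> 1 \<in> U"
      using \<gamma> by (auto simp: dip_def path_image_def image_subset_iff)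
    have m: "mor U \<gamma> \<in> Arr (fcat D U U)" using \<gamma> ends unfolding Arr_fcat by blast
    define k where "k = snd P (mor U \<gamma>)"
    have k: "k \<in> hom (fcat D U B) (fst P (\<gamma> 0)) (fst P (\<gamma> 1))"
      using P m unfolding k_def future_retract_def is_functor_def by fastforce
    have "k \<in> Arr (fcat D U U)" using k Arr_fcat_mono[OF B(1)] unfolding hom_def by blast
    have \<eta>: "\<eta> x \<in> hom (fcat D U U) x (fst P x)" if "x \<in> U" for x
      using P that unfolding future_retract_def by simp
    have nat: "Comp (fcat D U U) k (\<eta> (\<gamma> 0)) = Comp (fcat D U U) (\<eta> (\<gamma> 1)) (mor U \<gamma>)"
      using P m unfolding k_def future_retract_def by fastforce
    have I: "is_functor (fcat D U U) ?C (incl D X)" using UX by (intro functor_incl) auto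
    have "Comp ?C (snd (incl D X) k) (h (\<gamma> 0)) = snd (incl D X) (Comp (fcat D U U) k (\<eta> (\<gamma> 0)))"
      using I k \<open>k \<in> Arr (fcat D U U)\<close> \<eta>[OF ends(1)] ph[OF ends(1)] unfolding is_functor_def hom_def by simp
    also have "\<dots> = Comp ?C (h (\<gamma> 1)) (mor X \<gamma>)"
      using I m \<eta>[OF ends(2)] ph[OF ends(2)] incl_mor[OF \<gamma> UX]
      unfolding nat is_functor_def hom_def by simp
    finally have "Comp ?C (snd (incl D X) k) (h (\<gamma> 0)) = Comp ?C (h (\<gamma> 1)) (mor X \<gamma>)" .
    moreover have "snd (incl D X) k \<in> hom (fcat D X A) (p (\<gamma> 0)) (p (\<gamma> 1))"
      using functor_incl[of U X B A] UX B k ph[OF ends(1)] ph[OF ends(2)] unfolding is_functor_def hom_def by auto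
    moreover have "snd (incl D X) k \<in> S" using S k by (simp add: hom_def)
    ultimately show "Q \<gamma>" unfolding Q_def by blast
  next
    fix \<gamma> \<delta> assume D: "\<gamma> \<in> D" "\<delta> \<in> D" and e: "\<gamma> 1 = \<delta> 0" and "Q \<gamma>" "Q \<delta>"
    then obtain k l where k: "k \<in> S" "k \<in> hom (fcat D X A) (p (\<gamma> 0)) (p (\<gamma> 1))"
        "Comp ?C k (h (\<gamma> 0)) = Comp ?C (h (\<gamma> 1)) (mor X \<gamma>)"
      and l: "l \<in> S" "l \<in> hom (fcat D X A) (p (\<delta> 0)) (p (\<delta> 1))"
        "Comp ?C l (h (\<delta> 0)) = Comp ?C (h (\<delta> 1)) (mor X \<delta>)"
      unfolding Q_def by blast
    have homC: "f \<in> hom ?C x y" if "f \<in> hom (fcat D X A) x y" for f x y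
      using that Arr_fcat_mono[OF AX] unfolding hom_def by auto
    have X: "\<gamma> 0 \<in> X" "\<gamma> 1 \<in> X" "\<delta> 0 \<in> X" "\<delta> 1 \<in> X"
      using D_image[OF D(1)] D_image[OF D(2)] by (auto simp: path_image_def image_subset_iff)
    note hs = hC[OF X(1)] hC[OF X(3)] hC[OF X(4)]
    note km = homC[OF k(2)] homC[OF l(2)] mor_C[OF D(1)] mor_C[OF D(2)]
    \<comment> \<open>Pasting of the two naturality squares along the common edge h (\<delta> 0) = h
      (\<gamma> 1).\<close>
    have "Comp ?C (Comp ?C l k) (h (\<gamma> 0)) = Comp ?C l (Comp ?C k (h (\<gamma> 0)))"
      using hom_assoc[OF C hs(1) km(1)] km(2) e by simp
    also have "\<dots> = Comp ?C (Comp ?C l (h (\<delta> 0))) (mor X \<gamma>)"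
      using hom_assoc[OF C km(3)] hs(2) km(2) k(3) e by simp
    also have "\<dots> = Comp ?C (h (\<delta> 1)) (Comp ?C (mor X \<delta>) (mor X \<gamma>))"
      using hom_assoc[OF C km(3)] km(4) hs(3) l(3) e by simp
    also have "Comp ?C (mor X \<delta>) (mor X \<gamma>) = mor X (\<gamma> +++ \<delta>)"
      using D e by (intro Comp_fcat) (simp_all add: dip_space)
    finally have 1: "Comp ?C (Comp ?C l k) (h (\<gamma> 0)) = Comp ?C (h (\<delta> 1)) (mor X (\<gamma> +++ \<delta>))" .
    have "Comp (fcat D X A) l k \<in> S" using k l e by (intro comp) (auto simp: hom_def)
    moreover have "Comp (fcat D X A) l k \<in> hom (fcat D X A) (p (\<gamma> 0)) (p (\<delta> 1))"
      using hom_comp[OF category_fcat[OF AX subset_refl] k(2)] l(2) e by simp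
    moreover have "(\<gamma> +++ \<delta>) 0 = \<gamma> 0" "(\<gamma> +++ \<delta>) 1 = \<delta> 1" by (simp_all add: joinpaths_def)
    ultimately show "Q (\<gamma> +++ \<delta>)"
      using 1 unfolding Q_def Comp_fcat_indep[of X X A] by auto
  next
    fix \<gamma> \<delta> assume eq: "equivclp (dhtp D X) \<gamma> \<delta>" and D: "\<gamma> \<in> D" and Q: "Q \<gamma>"
    have "mor X \<gamma> = mor X \<delta>" "\<delta> 0 = \<gamma> 0" "\<delta> 1 = \<gamma> 1"
      using mor_eq[OF eq] equiv_dip[OF eq] D by (auto simp: dip_space)
    then show "Q \<delta>" using Q by (simp add: Q_def)
  qed
  \<comment> \<open>Both ends lie in \<open>A\<close>, where p fixes the point and h is an identity;
    the square then says that k is the class of \<gamma>.\<close>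
  then obtain k where k: "k \<in> S" "k \<in> hom (fcat D X A) (\<gamma> 0) (\<gamma> 1)"
      "Comp ?C k (Id ?C (\<gamma> 0)) = Comp ?C (Id ?C (\<gamma> 1)) (mor X \<gamma>)"
    using retract[OF f(2)] retract[OF f(3)] unfolding Q_def by (auto simp: Id_fcat)
  have "k \<in> hom ?C (\<gamma> 0) (\<gamma> 1)" using k(2) Arr_fcat_mono[OF AX] unfolding hom_def by auto
  then have "k = mor X \<gamma>"
    using k(3) hom_Id_left[OF C mor_C[OF f(1)]] hom_Id_right[OF C] by simp
  then show "f \<in> S" using k(1) f(4) by simp
qed

theorem theorem4p2:
  fixes X X0 X1 X2 A A0 A1 A2 :: "'a::topological_space set"
    and D :: "(real \<Rightarrow> 'a) set"
    and P0 P1 P2 :: "('a \<Rightarrow> 'a) \<times> ('a dmor \<Rightarrow> 'a dmor)"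
    and \<eta>0 \<eta>1 \<eta>2 :: "'a \<Rightarrow> 'a dmor"
  assumes dsp: "dspace X D"
    and X1X: "X1 \<subseteq> X" and X2X: "X2 \<subseteq> X"
    and Xint: "X = relint X X1 \<union> relint X X2"
    and Dconc: "\<forall>\<gamma>. \<gamma> \<in> D \<longleftrightarrow> fin_concat (\<lambda>\<delta>. \<delta> \<in> dip D X1 \<or> \<delta> \<in> dip D X2) \<gamma>"
    and X0: "X0 = X1 \<inter> X2"
    and A1X1: "A1 \<subseteq> X1" and A2X2: "A2 \<subseteq> X2"
    and A0: "A0 = A1 \<inter> A2" and A: "A = A1 \<union> A2"
    and Aint: "A = relint A A1 \<union> relint A A2"
    and FR0: "future_retract (fcat D X0 X0) (fcat D X0 A0) P0 \<eta>0"
    and FR1: "future_retract (fcat D X1 X1) (fcat D X1 A1) P1 \<eta>1"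
    and FR2: "future_retract (fcat D X2 X2) (fcat D X2 A2) P2 \<eta>2"
    and comm1: "feq (fcat D X0 X0) (fcomp P1 (incl D X1)) (fcomp (incl D X1) P0)"
    and comm2: "feq (fcat D X0 X0) (fcomp P2 (incl D X2)) (fcomp (incl D X2) P0)"
    and unit1: "\<forall>x\<in>X0. snd (incl D X1) (\<eta>0 x) = \<eta>1 x"
    and unit2: "\<forall>x\<in>X0. snd (incl D X2) (\<eta>0 x) = \<eta>2 x"
  shows "feq (fcat D X0 A0) (fcomp (incl D X) (incl D X1)) (fcomp (incl D X) (incl D X2)) \<and>
         (\<forall>E :: ('o, 'm) cat. category E \<longrightarrow>
            pushout_wrt (fcat D X0 A0) (fcat D X1 A1) (fcat D X2 A2) (fcat D X A)
              (incl D X1) (incl D X2) (incl D X) (incl D X) E)"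
proof -
  interpret covered_space X D "{X1, X2}"
    by unfold_locales (use dsp Xint X1X X2X in auto)
  have X0sub: "X0 \<subseteq> X1" "X0 \<subseteq> X2" "X0 \<subseteq> X" and A0sub: "A0 \<subseteq> X0" "A0 \<subseteq> A1" "A0 \<subseteq> A2"
    and AX: "A \<subseteq> X" and AkA: "A1 \<subseteq> A" "A2 \<subseteq> A"
    using X0 A0 A A1X1 A2X2 X1X X2X by auto
  have commutes: "feq (fcat D X0 A0) (fcomp (incl D X) (incl D X1)) (fcomp (incl D X) (incl D X2))"
    using incl_incl X0sub X1X X2X unfolding feq_def fcomp_def by (auto simp: incl_obj)
  \<comment> \<open>On the overlap both retractions and both units come from \<open>P0\<close> and
    \<open>\<eta>0\<close>, so the case distinctions in \<open>p\<close> and \<open>h\<close> below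
    are harmless.\<close>
  have P12: "fst P1 x = fst P2 x" if "x \<in> X0" for x
    using comm1 comm2 that by (simp add: feq_def fcomp_def)
  have \<eta>12: "snd (incl D X) (\<eta>1 x) = snd (incl D X) (\<eta>2 x)" if x: "x \<in> X0" for x
  proof -
    have "\<eta>0 x \<in> Arr (fcat D X0 X0)" using FR0 x unfolding future_retract_def hom_def by simp
    then show ?thesis
      using incl_incl[of "\<eta>0 x" X0 X0 _ X] X0sub X1X X2X unit1 unit2 x by metis
  qed
  define p where "p x = (if x \<in> X1 then fst P1 x else fst P2 x)" for x
  define h where "h x = (if x \<in> X1 then snd (incl D X) (\<eta>1 x) else snd (incl D X) (\<eta>2 x))" for x
  have p1: "p x = fst P1 x \<and> h x = snd (incl D X) (\<eta>1 x)" if "x \<in> X1" for x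
    using that by (simp add: p_def h_def)
  have p2: "p x = fst P2 x \<and> h x = snd (incl D X) (\<eta>2 x)" if "x \<in> X2" for x
    using that P12[of x] \<eta>12[of x] X0 by (simp add: p_def h_def)
  have unit_id: "snd (incl D X) (\<eta> a) = Id (fcat D X A) a"
    if "future_retract (fcat D Y Y) (fcat D Y B) P \<eta>" "a \<in> B" "B \<subseteq> Y" "Y \<subseteq> X" for Y B P \<eta> a
  proof -
    have "\<eta> a = mor Y (\<lambda>t. a)" using that unfolding future_retract_def by (simp add: Id_fcat)
    moreover have "(\<lambda>t. a) \<in> dip D Y" using that by (intro dip_const) auto
    ultimately show ?thesis using that(4) by (simp add: incl_mor Id_fcat)
  qed
  have ph_A: "p a = a \<and> h a = Id (fcat D X A) a" if a: "a \<in> A" for a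
  proof (cases "a \<in> A1")
    case True
    then show ?thesis
      using p1[of a] A1X1 X1X future_retract_id(1)[OF FR1] unit_id[OF FR1] by auto
  next
    case False
    then have "a \<in> A2" using a A by auto
    then show ?thesis
      using p2[of a] A2X2 X2X future_retract_id(1)[OF FR2] unit_id[OF FR2] by auto
  qed
  have "pushout_wrt (fcat D X0 A0) (fcat D X1 A1) (fcat D X2 A2) (fcat D X A)
          (incl D X1) (incl D X2) (incl D X) (incl D X) E" if E: "category E" for E :: "('o, 'm) cat"
    unfolding pushout_wrt_def
  proof (intro allI impI, elim conjE)
    fix F1 F2
    assume F1: "is_functor (fcat D X1 A1) E F1" and F2: "is_functor (fcat D X2 A2) E F2"
      and F12: "feq (fcat D X0 A0) (fcomp F1 (incl D X1)) (fcomp F2 (incl D X2))"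
    define G1 G2 where "G1 = fcomp F1 P1" and "G2 = fcomp F2 P2"
    have G1: "is_functor (fcat D X1 X1) E G1" and G2: "is_functor (fcat D X2 X2) E G2"
      unfolding G1_def G2_def
      by (rule is_functor_fcomp[OF future_retractD(1)[OF FR1] F1] is_functor_fcomp[OF future_retractD(1)[OF FR2] F2])+
    \<comment> \<open>\<open>F1\<close> and \<open>F2\<close> are known to agree only over
      \<open>A0\<close>; compatibility of the retractions routes every point of \<open>X0\<close>
      through \<open>P0\<close>, which lands there.\<close>
    have G12_ob: "fst G1 x = fst G2 x" if x: "x \<in> X0" for x
    proof -
      have "fst P0 x \<in> A0" using FR0 x unfolding future_retract_def is_functor_def by simp
      then show ?thesis
        using F12 comm1 comm2 x by (simp add: feq_def fcomp_def G1_def G2_def)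
    qed
    have G12_ar: "snd G1 (mor X1 \<gamma>) = snd G2 (mor X2 \<gamma>)" if \<gamma>: "\<gamma> \<in> dip D X0" for \<gamma>
    proof -
      have "\<gamma> 0 \<in> X0" "\<gamma> 1 \<in> X0" using \<gamma> by (auto simp: dip_def path_image_def image_subset_iff)
      then have m: "mor X0 \<gamma> \<in> Arr (fcat D X0 X0)" using \<gamma> unfolding Arr_fcat by blast
      then have P0: "snd P0 (mor X0 \<gamma>) \<in> Arr (fcat D X0 A0)"
        using FR0 unfolding future_retract_def is_functor_def hom_def by blast
      have "snd P1 (mor X1 \<gamma>) = snd (incl D X1) (snd P0 (mor X0 \<gamma>))"
        "snd P2 (mor X2 \<gamma>) = snd (incl D X2) (snd P0 (mor X0 \<gamma>))"
        using comm1 comm2 m incl_mor[OF \<gamma>] X0sub by (auto simp: feq_def fcomp_def)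
      then show ?thesis using F12 P0 by (simp add: feq_def fcomp_def G1_def G2_def)
    qed
    define ob where "ob x = (if x \<in> X1 then fst G1 x else fst G2 x)" for x
    define g where "g \<gamma> = (if \<gamma> \<in> dip D X1 then snd G1 (mor X1 \<gamma>) else snd G2 (mor X2 \<gamma>))" for \<gamma>
    \<comment> \<open>Hides which branch defines \<open>ob\<close> and \<open>g\<close>, so that the
      laws of a local functor are verified once for both members.\<close>
    have loc: "\<exists>G. is_functor (fcat D U U) E G \<and> (\<forall>x\<in>U. ob x = fst G x) \<and> (\<forall>\<gamma>\<in>dip D U. g \<gamma> = snd G (mor U \<gamma>))"
      if "U \<in> {X1, X2}" for U
    proof -
      have "ob x = fst G2 x" if "x \<in> X2" for x using that G12_ob[of x] X0 by (simp add: ob_def)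
      moreover have "g \<gamma> = snd G2 (mor X2 \<gamma>)" if "\<gamma> \<in> dip D X2" for \<gamma>
        using that G12_ar[of \<gamma>] X0 by (simp add: g_def dip_def)
      ultimately have "U = X2 \<Longrightarrow> ?thesis" using G2 by blast
      moreover have "U = X1 \<Longrightarrow> ?thesis" using G1 by (intro exI[of _ G1]) (simp add: ob_def g_def)
      ultimately show ?thesis using that by blast
    qed
    interpret local_functor X D "{X1, X2}" E ob g
    proof unfold_locales
      fix U \<gamma> \<delta> assume U: "U \<in> {X1, X2}"
      note UX = cover_subset[OF U]
      obtain G where G: "is_functor (fcat D U U) E G" "\<And>x. x \<in> U \<Longrightarrow> ob x = fst G x"
        "\<And>\<gamma>. \<gamma> \<in> dip D U \<Longrightarrow> g \<gamma> = snd G (mor U \<gamma>)" using loc[OF U] by blast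
      have in_U: "\<gamma> 0 \<in> U" "\<gamma> 1 \<in> U" if "\<gamma> \<in> dip D U" for \<gamma>
        using that by (auto simp: dip_def path_image_def image_subset_iff)
      note Gm = functor_mor[OF G(1) subset_refl UX]
      show "g \<gamma> \<in> hom E (ob (\<gamma> 0)) (ob (\<gamma> 1))" if "\<gamma> \<in> dip D U"
        using Gm(1)[OF that] in_U[OF that] G(2,3) that by simp
      show "g \<gamma> = g \<delta>" if "dhtp D U \<gamma> \<delta>"
        using dhtp_dip(1,2)[OF that] mor_eq[of U \<gamma> \<delta>] r_into_equivclp[of "dhtp D U", OF that] G(3) by simp
      show "g (\<gamma> +++ \<delta>) = Comp E (g \<delta>) (g \<gamma>)" if "\<gamma> \<in> dip D U" "\<delta> \<in> dip D U" "\<gamma> 1 = \<delta> 0"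
        using Gm(2)[of \<gamma> \<delta>] that in_U G(3) dip_join[OF that] by simp
    next
      fix x assume x: "x \<in> X"
      then obtain U where U: "U \<in> {X1, X2}" "x \<in> U" using in_cover by blast
      note UX = cover_subset[OF U(1)]
      obtain G where G: "is_functor (fcat D U U) E G" "\<And>x. x \<in> U \<Longrightarrow> ob x = fst G x"
        "\<And>\<gamma>. \<gamma> \<in> dip D U \<Longrightarrow> g \<gamma> = snd G (mor U \<gamma>)" using loc[OF U(1)] by blast
      show "g (\<lambda>t. x) = Id E (ob x)"
        using functor_mor(3)[OF G(1) subset_refl UX U(2)] G(2,3) dip_const[OF U(2) UX] U(2) by simp
    qed (rule E)
    obtain F where F: "is_functor (fcat D X A) E F" and F_ob: "\<And>x. fst F x = ob x"
      and F_mor: "\<And>U \<gamma>. U \<in> {X1, X2} \<Longrightarrow> \<gamma> \<in> dip D U \<Longrightarrow> snd F (mor X \<gamma>) = g \<gamma>"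
      using functor_extension[OF AX] by blast
    have extends: "feq (fcat D U B) (fcomp F (incl D X)) H"
      if U: "U \<in> {X1, X2}" "B \<subseteq> U" and R: "future_retract (fcat D U U) (fcat D U B) P \<eta>"
        and ob: "\<And>x. x \<in> U \<Longrightarrow> ob x = fst H (fst P x)"
        and g: "\<And>\<gamma>. \<gamma> \<in> dip D U \<Longrightarrow> g \<gamma> = snd H (snd P (mor U \<gamma>))" for U B P \<eta> H
    proof -
      note UX = cover_subset[OF U(1)]
      note id = future_retract_id[OF R U(2) UX]
      have "fst (fcomp F (incl D X)) x = fst H x" if "x \<in> B" for x
        using that U(2) F_ob ob[of x] id(1) by (auto simp: fcomp_def)
      moreover have "snd (fcomp F (incl D X)) f = snd H f" if f: "f \<in> Arr (fcat D U B)" for f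
      proof -
        obtain \<gamma> where \<gamma>: "\<gamma> \<in> dip D U" "f = mor U \<gamma>" using f unfolding Arr_fcat by blast
        then show ?thesis
          using F_mor[OF U(1) \<gamma>(1)] g[OF \<gamma>(1)] id(2)[OF f] incl_mor[OF \<gamma>(1) UX] by (simp add: fcomp_def)
      qed
      ultimately show ?thesis by (simp add: feq_def)
    qed
    have e1: "feq (fcat D X1 A1) (fcomp F (incl D X)) F1"
      by (rule extends[OF _ A1X1 FR1]) (simp_all add: ob_def g_def G1_def fcomp_def)
    have e2: "feq (fcat D X2 A2) (fcomp F (incl D X)) F2"
    proof (rule extends[OF _ A2X2 FR2])
      show "ob x = fst F2 (fst P2 x)" if "x \<in> X2" for x
        using that G12_ob[of x] X0 by (simp add: ob_def G2_def fcomp_def)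
      show "g \<gamma> = snd F2 (snd P2 (mor X2 \<gamma>))" if "\<gamma> \<in> dip D X2" for \<gamma>
        using that G12_ar[of \<gamma>] X0 by (simp add: g_def dip_def G2_def fcomp_def)
    qed simp
    have "feq (fcat D X A) F G"
      if G: "is_functor (fcat D X A) E G" and f1: "feq (fcat D X1 A1) (fcomp G (incl D X)) F1"
        and f2: "feq (fcat D X2 A2) (fcomp G (incl D X)) F2" for G
    proof -
      \<comment> \<open>The arrows on which both extensions agree are closed under composition and
        contain the images of the two subcategories, which is what \<open>arrows_generated\<close>
        requires.\<close>
      define S where "S = {f. snd F f = snd G f}"
      have S1: "snd (incl D X) f \<in> S" if "f \<in> Arr (fcat D X1 A1)" for f
        using e1 f1 that by (simp add: feq_def fcomp_def S_def)
      have S2: "snd (incl D X) f \<in> S" if "f \<in> Arr (fcat D X2 A2)" for f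
        using e2 f2 that by (simp add: feq_def fcomp_def S_def)
      have "Arr (fcat D X A) \<subseteq> S"
      proof (rule arrows_generated[OF AX, where p = p and h = h])
        fix U assume "U \<in> {X1, X2}"
        then consider "U = X1" | "U = X2" by blast
        then show "\<exists>B P \<eta>. B \<subseteq> U \<and> B \<subseteq> A \<and> future_retract (fcat D U U) (fcat D U B) P \<eta> \<and>
            (\<forall>x\<in>U. p x = fst P x \<and> h x = snd (incl D X) (\<eta> x)) \<and>
            (\<forall>f\<in>Arr (fcat D U B). snd (incl D X) f \<in> S)"
        proof cases
          case 1
          then show ?thesis using A1X1 AkA FR1 p1 S1 by blast
        next
          case 2
          then show ?thesis using A2X2 AkA FR2 p2 S2 by blast
        qed
      next
        fix f f' assume "f \<in> S" "f' \<in> S" "f \<in> Arr (fcat D X A)" "f' \<in> Arr (fcat D X A)"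
          "Dom (fcat D X A) f' = Cod (fcat D X A) f"
        then show "Comp (fcat D X A) f' f \<in> S"
          using F G unfolding is_functor_def S_def by simp
      qed (rule ph_A)
      moreover have "fst F x = fst G x" if "x \<in> A" for x
        using that A e1 e2 f1 f2 by (auto simp: feq_def fcomp_def)
      ultimately show ?thesis by (auto simp: feq_def S_def)
    qed
    then show "\<exists>F. is_functor (fcat D X A) E F \<and> feq (fcat D X1 A1) (fcomp F (incl D X)) F1 \<and>
        feq (fcat D X2 A2) (fcomp F (incl D X)) F2 \<and>
        (\<forall>G. is_functor (fcat D X A) E G \<and> feq (fcat D X1 A1) (fcomp G (incl D X)) F1 \<and>
             feq (fcat D X2 A2) (fcomp G (incl D X)) F2 \<longrightarrow> feq (fcat D X A) F G)"
      using F e1 e2 by blast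
  qed
  with commutes show ?thesis by blast
qed

end
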